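(* Let $d \ge 3$ and let $f : \mathbb{R}^d \to \mathbb{R}$ be a Gaussian field such that $$f(x) = f(x_1, \ldots, x_d) = g_1(x_1) + \cdots + g_d(x_d),$$ where $g_1, \ldots, g_d$ are independent centred stationary Gaussian processes on $\mathbb{R}$ with covariance kernels $K_i(t) = \mathbb{E}[g_i(0) g_i(t)]$, such that for each $i = 1, \ldots, d$: $g_i$ is not identically zero; $g_i$ is almost surely $C^2$-smooth; and $K_i(t) \log|t| \to 0$ as $|t| \to \infty$. Then $\ell_c = -\infty$, i.e. for every $\ell \in \mathbb{R}$, the set $\{f \le \ell\}$ has an unbounded connected component almost surely.
   Context: For $\ell \in \mathbb{R}$, $\{f \le \ell\} = \{x \in \mathbb{R}^d : f(x) \le \ell\}$. The critical level $\ell_c$ is the threshold such that for $\ell < \ell_c$ almost surely all connected components of $\{f \le \ell\}$ are bounded, and for $\ell > \ell_c$ almost surely $\{f \le \ell\}$ has an unbounded connected component; $\ell_c = -\infty$ means that $\{f \le \ell\}$ has an unbounded connected component almost surely for every $\ell \in \mathbb{R}$. *)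

theory Defs
  imports "HOL-Probability.Probability"
begin

(* Degenerate (almost surely constant) variables count as Gaussian, with standard deviation 0. *)
definition gaussian_rv :: "'w measure \<Rightarrow> ('w \<Rightarrow> real) \<Rightarrow> bool" where
  "gaussian_rv M X \<longleftrightarrow> X \<in> borel_measurable M \<and>
     (\<exists>m s. s \<ge> 0 \<and>
       (if s = 0 then AE \<omega> in M. X \<omega> = m
        else distributed M lborel X (normal_density m s)))"

definition gaussian_process :: "'w measure \<Rightarrow> ('t \<Rightarrow> 'w \<Rightarrow> real) \<Rightarrow> bool" where
  "gaussian_process M X \<longleftrightarrow>
     (\<forall>T a. finite T \<longrightarrow> gaussian_rv M (\<lambda>\<omega>. \<Sum>t\<in>T. a t * X t \<omega>))"

definition centred_process :: "'w measure \<Rightarrow> ('t \<Rightarrow> 'w \<Rightarrow> real) \<Rightarrow> bool" where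
  "centred_process M X \<longleftrightarrow> (\<forall>t. integrable M (X t) \<and> (\<integral>\<omega>. X t \<omega> \<partial>M) = 0)"

(* All finite-dimensional distributions are invariant under shifts of the parameter. *)
definition stationary_process :: "'w measure \<Rightarrow> (real \<Rightarrow> 'w \<Rightarrow> real) \<Rightarrow> bool" where
  "stationary_process M X \<longleftrightarrow>
     (\<forall>s T. finite T \<longrightarrow>
        distr M (Pi\<^sub>M T (\<lambda>_. borel)) (\<lambda>\<omega>. \<lambda>t\<in>T. X (t + s) \<omega>) =
        distr M (Pi\<^sub>M T (\<lambda>_. borel)) (\<lambda>\<omega>. \<lambda>t\<in>T. X t \<omega>))"

definition covariance_kernel :: "'w measure \<Rightarrow> (real \<Rightarrow> 'w \<Rightarrow> real) \<Rightarrow> real \<Rightarrow> real" where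
  "covariance_kernel M X t = (\<integral>\<omega>. X 0 \<omega> * X t \<omega> \<partial>M)"

(* Independence of whole processes, regarded as random elements of the product space
   of all real functions on the parameter set. *)
definition indep_processes :: "'w measure \<Rightarrow> ('i \<Rightarrow> 't \<Rightarrow> 'w \<Rightarrow> real) \<Rightarrow> bool" where
  "indep_processes M g \<longleftrightarrow>
     prob_space.indep_vars M (\<lambda>_. Pi\<^sub>M UNIV (\<lambda>_. borel)) (\<lambda>i \<omega> t. g i t \<omega>) UNIV"

definition C2_smooth :: "(real \<Rightarrow> real) \<Rightarrow> bool" where
  "C2_smooth h \<longleftrightarrow>
     (\<exists>h' h''. (\<forall>t. (h has_real_derivative h' t) (at t)) \<and>
               (\<forall>t. (h' has_real_derivative h'' t) (at t)) \<and>
               continuous_on UNIV h'')"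

definition sublevel_set :: "('x \<Rightarrow> 'w \<Rightarrow> real) \<Rightarrow> real \<Rightarrow> 'w \<Rightarrow> 'x set" where
  "sublevel_set f l \<omega> = {x. f x \<omega> \<le> l}"

definition is_critical_level ::
    "'w measure \<Rightarrow> ('x::real_normed_vector \<Rightarrow> 'w \<Rightarrow> real) \<Rightarrow> ereal \<Rightarrow> bool" where
  "is_critical_level M f c \<longleftrightarrow>
     (\<forall>l. ereal l < c \<longrightarrow> (AE \<omega> in M. \<forall>C\<in>components (sublevel_set f l \<omega>). bounded C)) \<and>
     (\<forall>l. c < ereal l \<longrightarrow> (AE \<omega> in M. \<exists>C\<in>components (sublevel_set f l \<omega>). \<not> bounded C))"

end

theory Submission
  imports Defs "HOL-Real_Asymp.Real_Asymp"
begin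

text \<open>
Moving three coordinates suffices. A stationary Gaussian process with covariance \<open>K\<close> satisfying
  \<open>K(t) log t \<rightarrow> 0\<close> behaves on long intervals like independent samples: on
  \<open>[0, exp(R\<^sup>2 / (2 K(0)))]\<close> its maximum is about \<open>R\<close> and its minimum about \<open>-R\<close>. The length of
  the interval depends on the process through \<open>K(0)\<close>, but the height \<open>R\<close> does not. So choose the
  interval of each coordinate according to its own variance. At a common scale \<open>R\<close>, two coordinates
  that sit at their minima contribute about \<open>-2R\<close> to the field, while the third one contributes at
  most about \<open>R\<close> wherever it is in its interval. The third coordinate can therefore travel freely,
  in particular to the place of its minimum at the next scale. Doing this with the three
  coordinates in turn gives a staircase along which the field tends to \<open>-\<infinity>\<close>; its corners leave
  every bounded set, because a continuous process is bounded below on bounded intervals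
  (\<open>unbounded_component_of_deep_valleys\<close>). All that is required of the constants is that the upper
  bound \<open>11/10 n\<close> on the peaks is smaller than twice the depth \<open>29/50 n\<close> of the valleys.

  The upper bound (\<open>eventually_upper_bound\<close>) is a union bound over a fixed grid together with
  dyadic chaining. The chaining needs \<open>E (X(2\<^sup>-\<^sup>q) - X(0))\<^sup>2 = O(4\<^sup>-\<^sup>q)\<close>; this holds since the difference
  quotients at 0 are centred normal and converge almost surely, so their variances are bounded.

  The lower bound (\<open>eventually_high_point\<close>, applied to the process and to its negative) has two
  parts. A second moment computation for \<open>\<Sum> exp(c X(t))\<close> over widely separated times shows that the
  level \<open>3/5 R\<close> is reached with probability at least 1/4 (\<open>prob_high_point_ge\<close>). As the decay of
  \<open>K(t) log t\<close> comes without a rate, this argument alone cannot make the failure probabilities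
  summable over the scales. The second part is a Poincare inequality: if \<open>F\<close> and \<open>F'\<close> are the maxima
  of two independent copies of a finite Gaussian family with variances at most \<open>v\<close>, then
  \<open>E (F - F')\<^sup>2 \<le> 4 \<pi>\<^sup>2 v\<close> whatever the number of variables (\<open>expectation_Max_diff_square\<close>). Hence a
  level slightly below one that is reached with probability 1/4 is missed at scale \<open>n\<close> with
  probability \<open>O(1/n\<^sup>2)\<close>, and the Borel--Cantelli lemma applies.

  The Poincare inequality is proved by rotating one copy into the other in small steps. In each step
  the maximum moves by the increment at a maximising index; this index depends only on the current
  position of the rotated family, which is independent of the orthogonal direction in which the family
  moves. That independence is read off the characteristic functions and Levy's uniqueness theorem.
\<close>

section \<open>Centred normal random variables\<close>

text \<open>
  The variance is a parameter and \<open>v = 0\<close> stands for the point mass at 0, so that the class is closed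
  under linear combinations of jointly Gaussian variables even when they degenerate.
\<close>

definition centred_normal :: "'w measure \<Rightarrow> real \<Rightarrow> ('w \<Rightarrow> real) \<Rightarrow> bool" where
  "centred_normal M v Y \<longleftrightarrow> Y \<in> borel_measurable M \<and> 0 \<le> v \<and>
     (if v = 0 then AE \<omega> in M. Y \<omega> = 0 else distributed M lborel Y (normal_density 0 (sqrt v)))"

lemma centred_normal_measurable: "centred_normal M v Y \<Longrightarrow> Y \<in> borel_measurable M"
  by (simp add: centred_normal_def)

text \<open>
  Completing the square: an exponential tilt moves the mean by the variance.
\<close>

lemma exp_times_normal_density:
  assumes "0 < \<sigma>"
  shows "normal_density 0 \<sigma> x * exp x = exp (\<sigma>\<^sup>2 / 2) * normal_density (\<sigma>\<^sup>2) \<sigma> x"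
proof -
  have "- (x\<^sup>2) / (2 * \<sigma>\<^sup>2) + x = \<sigma>\<^sup>2 / 2 - (x - \<sigma>\<^sup>2)\<^sup>2 / (2 * \<sigma>\<^sup>2)"
    using assms by (simp add: field_simps power2_eq_square)
  then have "exp (- (x\<^sup>2) / (2 * \<sigma>\<^sup>2)) * exp x = exp (\<sigma>\<^sup>2 / 2) * exp (- ((x - \<sigma>\<^sup>2)\<^sup>2) / (2 * \<sigma>\<^sup>2))"
    by (simp flip: exp_add)
  then show ?thesis
    by (simp add: normal_density_def)
qed

lemma one_minus_cos_le: "1 - cos h \<le> h\<^sup>2 / 2" for h :: real
proof -
  have "1 - cos h = 2 * (sin (h / 2))\<^sup>2" using cos_double_sin[of "h / 2"] by simp
  also have "(sin (h / 2))\<^sup>2 \<le> (h / 2)\<^sup>2" using abs_sin_x_le_abs_x[of "h / 2"] by (simp only: abs_le_square_iff)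
  finally show ?thesis by (simp add: power_divide)
qed

context prob_space
begin

lemma centred_normal_exp:
  assumes "centred_normal M v Y"
  shows "integrable M (\<lambda>\<omega>. exp (Y \<omega>))" "expectation (\<lambda>\<omega>. exp (Y \<omega>)) = exp (v / 2)"
proof -
  note [measurable] = centred_normal_measurable[OF assms]
  have "integrable M (\<lambda>\<omega>. exp (Y \<omega>)) \<and> expectation (\<lambda>\<omega>. exp (Y \<omega>)) = exp (v / 2)"
  proof (cases "v = 0")
    case True
    then have ae: "AE \<omega> in M. exp (Y \<omega>) = 1"
      using assms by (auto simp: centred_normal_def)
    have "integrable M (\<lambda>\<omega>. exp (Y \<omega>)) \<longleftrightarrow> integrable M (\<lambda>_. 1::real)"
      by (rule integrable_cong_AE) (use ae in auto)
    moreover have "expectation (\<lambda>\<omega>. exp (Y \<omega>)) = expectation (\<lambda>_. 1)"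
      by (rule integral_cong_AE) (use ae in auto)
    ultimately show ?thesis using True by (simp add: prob_space)
  next
    case False
    then have v: "0 < v" and D: "distributed M lborel Y (normal_density 0 (sqrt v))"
      using assms by (auto simp: centred_normal_def)
    have eq: "(\<lambda>x. normal_density 0 (sqrt v) x * exp x) = (\<lambda>x. exp (v / 2) * normal_density v (sqrt v) x)"
      using exp_times_normal_density[of "sqrt v"] v by auto
    have "integrable M (\<lambda>\<omega>. exp (Y \<omega>))"
      by (subst distributed_integrable[OF D, symmetric]) (use v in \<open>auto simp: eq\<close>)
    moreover have "expectation (\<lambda>\<omega>. exp (Y \<omega>)) = exp (v / 2)"
      by (subst distributed_integral[OF D, symmetric]) (use v in \<open>auto simp: eq\<close>)
    ultimately show ?thesis by simp
  qed
  then show "integrable M (\<lambda>\<omega>. exp (Y \<omega>))" "expectation (\<lambda>\<omega>. exp (Y \<omega>)) = exp (v / 2)"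
    by auto
qed

lemma centred_normal_square:
  assumes "centred_normal M v Y"
  shows "integrable M (\<lambda>\<omega>. (Y \<omega>)\<^sup>2)" "expectation (\<lambda>\<omega>. (Y \<omega>)\<^sup>2) = v"
proof -
  note [measurable] = centred_normal_measurable[OF assms]
  have "integrable M (\<lambda>\<omega>. (Y \<omega>)\<^sup>2) \<and> expectation (\<lambda>\<omega>. (Y \<omega>)\<^sup>2) = v"
  proof (cases "v = 0")
    case True
    then have ae: "AE \<omega> in M. (Y \<omega>)\<^sup>2 = 0"
      using assms by (auto simp: centred_normal_def)
    have "integrable M (\<lambda>\<omega>. (Y \<omega>)\<^sup>2) \<longleftrightarrow> integrable M (\<lambda>_. 0::real)"
      by (rule integrable_cong_AE) (use ae in auto)
    moreover have "expectation (\<lambda>\<omega>. (Y \<omega>)\<^sup>2) = expectation (\<lambda>_. 0)"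
      by (rule integral_cong_AE) (use ae in auto)
    ultimately show ?thesis using True by simp
  next
    case False
    then have v: "0 < v" and D: "distributed M lborel Y (normal_density 0 (sqrt v))"
      using assms by (auto simp: centred_normal_def)
    have "integrable M (\<lambda>\<omega>. (Y \<omega>)\<^sup>2)"
      by (subst distributed_integrable[OF D, symmetric])
        (use v integrable_normal_moment[of "sqrt v" 0 2] in auto)
    moreover have "expectation (\<lambda>\<omega>. (Y \<omega>)\<^sup>2) = v"
      by (subst distributed_integral[OF D, symmetric])
        (use v integral_normal_moment_even[of "sqrt v" 0 1] in \<open>auto simp: fact_numeral\<close>)
    ultimately show ?thesis by simp
  qed
  then show "integrable M (\<lambda>\<omega>. (Y \<omega>)\<^sup>2)" "expectation (\<lambda>\<omega>. (Y \<omega>)\<^sup>2) = v"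
    by auto
qed

lemma centred_normal_iexp:
  assumes "centred_normal M v Y"
  shows "(CLINT \<omega>|M. iexp (Y \<omega>)) = of_real (exp (- v / 2))"
proof -
  note [measurable] = centred_normal_measurable[OF assms]
  show ?thesis
  proof (cases "v = 0")
    case True
    then have ae: "AE \<omega> in M. iexp (Y \<omega>) = 1"
      using assms by (auto simp: centred_normal_def)
    have "(CLINT \<omega>|M. iexp (Y \<omega>)) = (CLINT \<omega>|M. 1)"
      by (rule integral_cong_AE) (use ae in auto)
    then show ?thesis using True by (simp add: prob_space)
  next
    case False
    then have v: "0 < v" and D: "distributed M lborel Y (normal_density 0 (sqrt v))"
      using assms by (auto simp: centred_normal_def)
    then have D': "distributed M lborel (\<lambda>\<omega>. Y \<omega> / sqrt v) std_normal_density"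
      using normal_standard_normal_convert[of "sqrt v" Y 0] by simp
    have "(CLINT \<omega>|M. iexp (Y \<omega>)) = (CLINT \<omega>|M. iexp (sqrt v * (Y \<omega> / sqrt v)))"
      using v by simp
    also have "\<dots> = (CLINT x|distr M lborel (\<lambda>\<omega>. Y \<omega> / sqrt v). iexp (sqrt v * x))"
      by (subst integral_distr) auto
    also have "\<dots> = char std_normal_distribution (sqrt v)"
      unfolding char_def distributed_distr_eq_density[OF D'] by simp
    also have "\<dots> = of_real (exp (- v / 2))"
      using v by (simp add: char_std_normal_distribution)
    finally show ?thesis .
  qed
qed

lemma centred_normal_scale:
  assumes "centred_normal M v Y"
  shows "centred_normal M (c\<^sup>2 * v) (\<lambda>\<omega>. c * Y \<omega>)"
proof (cases "v = 0 \<or> c = 0")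
  case True
  then show ?thesis using assms by (auto simp: centred_normal_def)
next
  case False
  then have v: "0 < v" "c \<noteq> 0" and D: "distributed M lborel Y (normal_density 0 (sqrt v))"
    using assms by (auto simp: centred_normal_def)
  then have "distributed M lborel (\<lambda>\<omega>. 0 + c * Y \<omega>) (normal_density (0 + c * 0) (\<bar>c\<bar> * sqrt v))"
    by (intro normal_density_affine) auto
  then show ?thesis
    using v centred_normal_measurable[OF assms] by (simp add: centred_normal_def real_sqrt_mult)
qed

lemma centred_normal_exp_scale:
  assumes "centred_normal M v Y"
  shows "integrable M (\<lambda>\<omega>. exp (c * Y \<omega>))" "expectation (\<lambda>\<omega>. exp (c * Y \<omega>)) = exp (c\<^sup>2 * v / 2)"
  using centred_normal_exp[OF centred_normal_scale[OF assms, of c]] by auto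

text \<open>
  Markov's inequality for \<open>exp(c Y)\<close> with the optimal \<open>c = u / w\<close>. Only an upper bound \<open>w\<close> of the
  variance enters, so \<open>Y\<close> may be degenerate.
\<close>

lemma centred_normal_tail:
  assumes Y: "centred_normal M v Y" and w: "v \<le> w" "0 < w" and u: "0 < u"
  shows "prob {\<omega> \<in> space M. u \<le> Y \<omega>} \<le> exp (- (u\<^sup>2) / (2 * w))"
proof -
  note [measurable] = centred_normal_measurable[OF Y]
  define c where "c = u / w"
  have c: "0 < c" using u w by (simp add: c_def)
  have "{\<omega> \<in> space M. u \<le> Y \<omega>} = {\<omega> \<in> space M. exp (c * u) \<le> exp (c * Y \<omega>)}"
    using c by simp
  also have "prob \<dots> \<le> expectation (\<lambda>\<omega>. exp (c * Y \<omega>)) / exp (c * u)"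
    by (rule integral_Markov_inequality_measure[where A = "space M" and M = M])
      (use centred_normal_exp_scale[OF Y] in auto)
  also have "\<dots> = exp (c\<^sup>2 * v / 2 - c * u)"
    by (simp add: centred_normal_exp_scale[OF Y] exp_diff)
  also have "\<dots> \<le> exp (c\<^sup>2 * w / 2 - c * u)"
    using w by (simp add: mult_left_mono)
  also have "c\<^sup>2 * w / 2 - c * u = - (u\<^sup>2) / (2 * w)"
    using w by (simp add: c_def field_simps power2_eq_square)
  finally show ?thesis .
qed

lemma centred_normal_cos:
  assumes "centred_normal M v Y"
  shows "expectation (\<lambda>\<omega>. cos (Y \<omega>)) = exp (- v / 2)"
proof -
  note [measurable] = centred_normal_measurable[OF assms]
  have "integrable M (\<lambda>\<omega>. iexp (Y \<omega>))" by (rule integrable_const_bound[of _ 1]) auto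
  then have "expectation (\<lambda>\<omega>. Re (iexp (Y \<omega>))) = Re (CLINT \<omega>|M. iexp (Y \<omega>))"
    by (rule integral_Re)
  then show ?thesis by (simp only: centred_normal_iexp[OF assms]) (simp add: Re_exp)
qed

text \<open>
  Variances of an almost surely bounded sequence cannot escape to infinity. If all \<open>Y n\<close> lie in
  \<open>[-m, m]\<close> simultaneously with probability above 3/4, then \<open>E cos(Y n / m)\<close> is at least 1/8, because
  the cosine is at least 1/2 on this event and at least -1 off it; but this expectation equals
  \<open>exp(-v n / (2 m\<^sup>2))\<close>.
\<close>

lemma centred_normal_variances_bounded:
  assumes Y: "\<And>n::nat. centred_normal M (v n) (Y n)" and bdd: "AE \<omega> in M. bounded (range (\<lambda>n. Y n \<omega>))"
  obtains C where "0 < C" "\<And>n. v n \<le> C"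
proof -
  have [measurable]: "Y n \<in> borel_measurable M" for n using Y centred_normal_measurable by blast
  define A where "A = (\<lambda>m::nat. {\<omega> \<in> space M. \<forall>n. \<bar>Y n \<omega>\<bar> \<le> m})"
  have [measurable]: "A m \<in> sets M" for m unfolding A_def by measurable
  have "AE \<omega> in M. \<omega> \<in> (\<Union>m. A m)"
    using bdd AE_space
  proof eventually_elim
    case (elim \<omega>)
    then obtain B where B: "\<And>n. \<bar>Y n \<omega>\<bar> \<le> B" by (auto simp: bounded_iff)
    obtain m :: nat where "B \<le> m" using real_arch_simple by blast
    then have "\<omega> \<in> A m" using B elim(2) by (auto simp: A_def intro: order_trans)
    then show ?case by auto
  qed
  then have "prob (\<Union>m. A m) = 1" by (subst prob_eq_1) auto
  moreover have "(\<lambda>m. prob (A m)) \<longlonglongrightarrow> prob (\<Union>m. A m)"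
    by (rule finite_Lim_measure_incseq) (auto simp: incseq_def A_def intro: order_trans)
  ultimately have "eventually (\<lambda>m. 3/4 < prob (A m)) sequentially"
    by (intro order_tendstoD(1)[where y = "prob (\<Union>m. A m)"]) auto
  then have "eventually (\<lambda>m. 3/4 < prob (A m) \<and> 1 \<le> m) sequentially"
    using eventually_ge_at_top[of 1] by eventually_elim auto
  then obtain m where m: "3/4 < prob (A m)" "1 \<le> m" by (auto simp: eventually_sequentially)
  have "v n \<le> 2 * (real m)\<^sup>2 * ln 8" for n
  proof -
    have N: "centred_normal M ((1/m)\<^sup>2 * v n) (\<lambda>\<omega>. (1/m) * Y n \<omega>)" by (rule centred_normal_scale[OF Y])
    \<comment> \<open>On \<open>A m\<close> the cosine is at least 1/2, and elsewhere at least -1.\<close>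
    have "3/2 * (3/4) - 1 \<le> 3/2 * prob (A m) - 1" using m by simp
    also have "\<dots> = expectation (\<lambda>\<omega>. 3/2 * indicat_real (A m) \<omega> - 1)"
    proof -
      have "integrable M (\<lambda>\<omega>. 3/2 * indicat_real (A m) \<omega>)"
        by (rule integrable_const_bound[of _ "3/2"]) (auto simp: indicator_def)
      then show ?thesis by (subst Bochner_Integration.integral_diff) (auto simp: prob_space)
    qed
    also have "\<dots> \<le> expectation (\<lambda>\<omega>. cos ((1/m) * Y n \<omega>))"
    proof (rule integral_mono)
      show "integrable M (\<lambda>\<omega>. 3/2 * indicat_real (A m) \<omega> - 1)"
        by (rule integrable_const_bound[of _ 1]) (auto simp: indicator_def)
      show "integrable M (\<lambda>\<omega>. cos ((1/m) * Y n \<omega>))" by (rule integrable_const_bound[of _ 1]) auto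
      fix \<omega>
      show "3/2 * indicat_real (A m) \<omega> - 1 \<le> cos ((1/m) * Y n \<omega>)"
      proof (cases "\<omega> \<in> A m")
        case True
        then have "\<bar>(1/m) * Y n \<omega>\<bar> \<le> 1" using m by (simp add: A_def abs_mult divide_le_eq)
        then have "((1/m) * Y n \<omega>)\<^sup>2 \<le> 1" by (simp only: abs_square_le_1)
        then show ?thesis using one_minus_cos_le[of "(1/m) * Y n \<omega>"] True by simp
      qed simp
    qed
    also have "\<dots> = exp (- ((1/m)\<^sup>2 * v n) / 2)" by (rule centred_normal_cos[OF N])
    finally have "1/8 \<le> exp (- ((1/m)\<^sup>2 * v n) / 2)" by simp
    then have "ln (1/8) \<le> ln (exp (- ((1/m)\<^sup>2 * v n) / 2))" by (subst ln_le_cancel_iff) auto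
    then have "(1/m)\<^sup>2 * v n \<le> 2 * ln 8" by (simp add: ln_div)
    then show ?thesis using m by (simp add: power_divide field_simps)
  qed
  moreover have "0 < 2 * (real m)\<^sup>2 * ln 8" using m by simp
  ultimately show ?thesis using that by blast
qed

end

section \<open>Independence from Fourier transforms\<close>

text \<open>
  The measures with densities \<open>max W 0\<close> and \<open>max (-W) 0\<close>, transported by \<open>X\<close>, have the same total mass
  (take \<open>s = 0\<close>) and the same characteristic function, so they agree by Levy's uniqueness theorem.
\<close>

lemma integral_eq_0_of_fourier_transform_real:
  fixes W X :: "'a \<Rightarrow> real" and h :: "real \<Rightarrow> real"
  assumes W: "integrable M W" and X[measurable]: "X \<in> borel_measurable M"
    and F: "\<And>s. (CLINT \<omega>|M. of_real (W \<omega>) * iexp (s * X \<omega>)) = 0"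
    and h[measurable]: "h \<in> borel_measurable borel"
    and i: "integrable M (\<lambda>\<omega>. W \<omega> * h (X \<omega>))"
  shows "(LINT \<omega>|M. W \<omega> * h (X \<omega>)) = 0"
proof -
  note [measurable] = borel_measurable_integrable[OF W]
  define P where "P = (\<lambda>\<omega>. max (W \<omega>) 0)"
  define N where "N = (\<lambda>\<omega>. max (- W \<omega>) 0)"
  have PN: "W \<omega> = P \<omega> - N \<omega>" "P \<omega> \<ge> 0" "N \<omega> \<ge> 0" "P \<omega> \<le> \<bar>W \<omega>\<bar>" "N \<omega> \<le> \<bar>W \<omega>\<bar>" for \<omega>
    by (auto simp: P_def N_def max_def)
  have [measurable]: "P \<in> borel_measurable M" "N \<in> borel_measurable M"
    by (simp_all add: P_def N_def)
  have iP: "integrable M P" and iN: "integrable M N"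
    by (rule Bochner_Integration.integrable_bound[OF W]; use PN in simp)+
  define c where "c = (LINT \<omega>|M. P \<omega>)"
  have c: "c = (LINT \<omega>|M. N \<omega>)"
  proof -
    have "complex_of_real (LINT \<omega>|M. W \<omega>) = 0" using F[of 0] by simp
    then have "(LINT \<omega>|M. W \<omega>) = 0" by (simp only: of_real_eq_0_iff)
    then show ?thesis using iP iN by (simp add: PN(1) c_def)
  qed
  have "c \<ge> 0" using PN by (simp add: c_def)
  have iPh: "integrable M (\<lambda>\<omega>. P \<omega> * h (X \<omega>))" and iNh: "integrable M (\<lambda>\<omega>. N \<omega> * h (X \<omega>))"
    by (rule Bochner_Integration.integrable_bound[OF i];
        use PN in \<open>auto simp: abs_mult intro!: mult_right_mono\<close>)+
  show ?thesis
  proof (cases "c = 0")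
    case True
    have "AE \<omega> in M. P \<omega> = 0"
      using integral_nonneg_eq_0_iff_AE[OF iP] True PN(2) by (simp add: c_def)
    moreover have "AE \<omega> in M. N \<omega> = 0"
      using integral_nonneg_eq_0_iff_AE[OF iN] True PN(3) c by simp
    ultimately have "AE \<omega> in M. W \<omega> * h (X \<omega>) = 0" by eventually_elim (simp add: PN)
    then show ?thesis by (simp add: integral_eq_zero_AE)
  next
    case False
    with \<open>c \<ge> 0\<close> have c0: "c > 0" by simp
    define \<mu> where "\<mu> = (\<lambda>P::'a \<Rightarrow> real. distr (density M (\<lambda>\<omega>. ennreal (P \<omega> / c))) borel X)"
    have int: "(LINT x|\<mu> Q. k x) = (LINT \<omega>|M. (Q \<omega> / c) *\<^sub>R k (X \<omega>))"
      if [measurable]: "Q \<in> borel_measurable M" and "\<And>\<omega>. Q \<omega> \<ge> 0" and [measurable]: "k \<in> borel_measurable borel"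
      for Q and k :: "real \<Rightarrow> 'b :: {banach, second_countable_topology}"
      unfolding \<mu>_def using that c0
      by (subst integral_distr) (auto simp: integral_density)
    have rd: "real_distribution (\<mu> Q)"
      if [measurable]: "Q \<in> borel_measurable M" and "\<And>\<omega>. Q \<omega> \<ge> 0" and iQ: "integrable M Q" and Qc: "(LINT \<omega>|M. Q \<omega>) = c"
      for Q
    proof -
      have "prob_space (density M (\<lambda>\<omega>. ennreal (Q \<omega> / c)))"
      proof
        have "emeasure (density M (\<lambda>\<omega>. ennreal (Q \<omega> / c))) (space M) = (\<integral>\<^sup>+\<omega>. ennreal (Q \<omega> / c) \<partial>M)"
          by (simp add: emeasure_density cong: nn_integral_cong)
        also have "\<dots> = ennreal (LINT \<omega>|M. Q \<omega> / c)"
          using iQ that c0 by (intro nn_integral_eq_integral) auto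
        also have "\<dots> = 1" using Qc c0 by simp
        finally show "emeasure (density M (\<lambda>\<omega>. ennreal (Q \<omega> / c))) (space (density M (\<lambda>\<omega>. ennreal (Q \<omega> / c)))) = 1"
          by simp
      qed
      then interpret prob_space "density M (\<lambda>\<omega>. ennreal (Q \<omega> / c))" .
      show ?thesis unfolding \<mu>_def
        by (rule real_distribution_distr) simp
    qed
    have "char (\<mu> P) = char (\<mu> N)"
    proof
      fix s
      have iiP: "integrable M (\<lambda>\<omega>. (P \<omega> / c) *\<^sub>R iexp (s * X \<omega>))"
        by (rule Bochner_Integration.integrable_bound[of M "\<lambda>\<omega>. P \<omega> / c"])
           (use iP PN c0 in \<open>auto simp: norm_mult simp flip: of_real_mult\<close>)
      have iiN: "integrable M (\<lambda>\<omega>. (N \<omega> / c) *\<^sub>R iexp (s * X \<omega>))"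
        by (rule Bochner_Integration.integrable_bound[of M "\<lambda>\<omega>. N \<omega> / c"])
           (use iN PN c0 in \<open>auto simp: norm_mult simp flip: of_real_mult\<close>)
      have "char (\<mu> P) s - char (\<mu> N) s = (CLINT \<omega>|M. (P \<omega> / c) *\<^sub>R iexp (s * X \<omega>)) - (CLINT \<omega>|M. (N \<omega> / c) *\<^sub>R iexp (s * X \<omega>))"
        unfolding char_def using PN by (subst (1 2) int) auto
      also have "\<dots> = (CLINT \<omega>|M. (P \<omega> / c) *\<^sub>R iexp (s * X \<omega>) - (N \<omega> / c) *\<^sub>R iexp (s * X \<omega>))"
        using iiP iiN by simp
      also have "\<dots> = (CLINT \<omega>|M. of_real (1/c) * (of_real (W \<omega>) * iexp (s * X \<omega>)))"
      proof (rule Bochner_Integration.integral_cong[OF refl])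
        fix \<omega>
        have "of_real (P \<omega> / c) * e - of_real (N \<omega> / c) * e = of_real (1 / c) * (of_real (P \<omega> - N \<omega>) * e)" for e :: complex
          using c0 by (simp add: field_simps)
        then show "(P \<omega> / c) *\<^sub>R iexp (s * X \<omega>) - (N \<omega> / c) *\<^sub>R iexp (s * X \<omega>) =
            of_real (1 / c) * (of_real (W \<omega>) * iexp (s * X \<omega>))"
          by (simp only: PN(1) scaleR_conv_of_real)
      qed
      also have "\<dots> = 0" by (simp only: F integral_mult_right_zero mult_zero_right)
      finally show "char (\<mu> P) s = char (\<mu> N) s" by simp
    qed
    then have "\<mu> P = \<mu> N"
      by (intro Levy_uniqueness rd) (use PN iP iN c in \<open>auto simp: c_def\<close>)
    then have "(LINT \<omega>|M. (P \<omega> / c) *\<^sub>R h (X \<omega>)) = (LINT \<omega>|M. (N \<omega> / c) *\<^sub>R h (X \<omega>))"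
      using int[of P h] int[of N h] PN by auto
    then have "(LINT \<omega>|M. P \<omega> * h (X \<omega>)) = (LINT \<omega>|M. N \<omega> * h (X \<omega>))"
      using c0 by simp
    then show ?thesis using iPh iNh by (simp add: PN(1) left_diff_distrib)
  qed
qed

text \<open>
  The conjugate of \<open>W\<close> satisfies the same hypothesis, as \<open>s\<close> takes both signs. The real and imaginary
  parts of \<open>W\<close> therefore satisfy it separately, and the real case applies to each.
\<close>

lemma integral_eq_0_of_fourier_transform:
  fixes W :: "'a \<Rightarrow> complex" and X :: "'a \<Rightarrow> real" and h :: "real \<Rightarrow> real"
  assumes W: "integrable M W" and X[measurable]: "X \<in> borel_measurable M"
    and F: "\<And>s. (CLINT \<omega>|M. W \<omega> * iexp (s * X \<omega>)) = 0"
    and h[measurable]: "h \<in> borel_measurable borel"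
    and i: "integrable M (\<lambda>\<omega>. W \<omega> * of_real (h (X \<omega>)))"
  shows "(CLINT \<omega>|M. W \<omega> * of_real (h (X \<omega>))) = 0"
proof -
  note [measurable] = borel_measurable_integrable[OF W]
  have int: "integrable M (\<lambda>\<omega>. W \<omega> * iexp (s * X \<omega>))" for s
    by (rule Bochner_Integration.integrable_bound[OF W]) (auto simp: norm_mult simp flip: of_real_mult)
  have cnj: "cnj (iexp (s * x)) = iexp (- s * x)" for s x
    by (simp add: exp_cnj)
  have intc: "integrable M (\<lambda>\<omega>. cnj (W \<omega>) * iexp (s * X \<omega>))" for s
    using integrable_cnj[OF int[of "- s"]] by (simp add: exp_cnj)
  have Fc: "(CLINT \<omega>|M. cnj (W \<omega>) * iexp (s * X \<omega>)) = 0" for s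
  proof -
    have "(CLINT \<omega>|M. cnj (W \<omega>) * iexp (s * X \<omega>)) = (CLINT \<omega>|M. cnj (W \<omega> * iexp (- s * X \<omega>)))"
      by (simp only: complex_cnj_mult cnj) simp
    also have "\<dots> = cnj (CLINT \<omega>|M. W \<omega> * iexp (- s * X \<omega>))"
      by (rule Bochner_Integration.integral_cnj)
    finally show ?thesis using F[of "- s"] by simp
  qed
  have Re: "(LINT \<omega>|M. Re (W \<omega>) * h (X \<omega>)) = 0"
  proof (rule integral_eq_0_of_fourier_transform_real[where X = X and h = h])
    show "integrable M (\<lambda>\<omega>. Re (W \<omega>))" using W by simp
    have "integrable M (\<lambda>\<omega>. Re (W \<omega> * of_real (h (X \<omega>))))" using i by (rule integrable_Re)
    then show "integrable M (\<lambda>\<omega>. Re (W \<omega>) * h (X \<omega>))" by simp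
    fix s
    have "(CLINT \<omega>|M. of_real (Re (W \<omega>)) * iexp (s * X \<omega>)) =
        (CLINT \<omega>|M. (1/2) * (W \<omega> * iexp (s * X \<omega>) + cnj (W \<omega>) * iexp (s * X \<omega>)))"
    proof (rule Bochner_Integration.integral_cong[OF refl])
      fix \<omega>
      have "complex_of_real (Re (W \<omega>)) = (1/2) * (W \<omega> + cnj (W \<omega>))" by (simp add: complex_add_cnj)
      then show "of_real (Re (W \<omega>)) * iexp (s * X \<omega>) = (1/2) * (W \<omega> * iexp (s * X \<omega>) + cnj (W \<omega>) * iexp (s * X \<omega>))"
        by (simp only: algebra_simps)
    qed
    also have "\<dots> = 0" using F[of s] Fc[of s] int[of s] intc[of s] by (simp del: of_real_mult)
    finally show "(CLINT \<omega>|M. of_real (Re (W \<omega>)) * iexp (s * X \<omega>)) = 0" .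
  qed simp_all
  have Im: "(LINT \<omega>|M. Im (W \<omega>) * h (X \<omega>)) = 0"
  proof (rule integral_eq_0_of_fourier_transform_real[where X = X and h = h])
    show "integrable M (\<lambda>\<omega>. Im (W \<omega>))" using W by simp
    have "integrable M (\<lambda>\<omega>. Im (W \<omega> * of_real (h (X \<omega>))))" using i by (rule integrable_Im)
    then show "integrable M (\<lambda>\<omega>. Im (W \<omega>) * h (X \<omega>))" by simp
    fix s
    have "(CLINT \<omega>|M. of_real (Im (W \<omega>)) * iexp (s * X \<omega>)) =
        (CLINT \<omega>|M. (- \<i>/2) * (W \<omega> * iexp (s * X \<omega>) - cnj (W \<omega>) * iexp (s * X \<omega>)))"
    proof (rule Bochner_Integration.integral_cong[OF refl])
      fix \<omega>
      have "complex_of_real (Im (W \<omega>)) = (- \<i>/2) * (W \<omega> - cnj (W \<omega>))" by (simp add: complex_eq_iff)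
      then show "of_real (Im (W \<omega>)) * iexp (s * X \<omega>) = (- \<i>/2) * (W \<omega> * iexp (s * X \<omega>) - cnj (W \<omega>) * iexp (s * X \<omega>))"
        by (simp only: left_diff_distrib mult.assoc)
    qed
    also have "\<dots> = 0" using F[of s] Fc[of s] int[of s] intc[of s] by (simp del: of_real_mult)
    finally show "(CLINT \<omega>|M. of_real (Im (W \<omega>)) * iexp (s * X \<omega>)) = 0" .
  qed simp_all
  show ?thesis
    using Re Im i by (simp add: complex_eq_iff flip: integral_Re integral_Im)
qed

text \<open>
  Uniqueness in several variables reduces to one variable: the indicator of one coordinate at a
  time is absorbed into the complex weight \<open>W\<close>, which is why \<open>W\<close> is arbitrary in the induction.
\<close>

lemma integral_eq_0_of_fourier_transform_family:
  fixes W :: "'a \<Rightarrow> complex" and X :: "'t \<Rightarrow> 'a \<Rightarrow> real"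
  assumes "finite T" and "integrable M W" and "\<And>t. t \<in> T \<Longrightarrow> X t \<in> borel_measurable M"
    and "\<And>a. (CLINT \<omega>|M. W \<omega> * iexp (\<Sum>t\<in>T. a t * X t \<omega>)) = 0"
    and "\<And>t. t \<in> T \<Longrightarrow> A t \<in> sets borel"
  shows "(CLINT \<omega>|M. W \<omega> * of_bool (\<forall>t\<in>T. X t \<omega> \<in> A t)) = 0"
  using assms
proof (induction T arbitrary: W rule: finite_induct)
  case empty
  then show ?case by simp
next
  case (insert t T)
  note [measurable] = borel_measurable_integrable[OF insert.prems(1)]
  have mX[measurable]: "u \<in> insert t T \<Longrightarrow> X u \<in> borel_measurable M" for u using insert.prems by simp
  have [measurable]: "X t \<in> borel_measurable M" "A t \<in> sets borel" using insert.prems by auto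
  let ?W = "\<lambda>\<omega>. W \<omega> * of_real (indicat_real (A t) (X t \<omega>))"
  have iW: "integrable M ?W"
    by (rule Bochner_Integration.integrable_bound[OF insert.prems(1)]) (auto simp: norm_mult indicator_def)
  have "(CLINT \<omega>|M. ?W \<omega> * of_bool (\<forall>t\<in>T. X t \<omega> \<in> A t)) = 0"
  proof (rule insert.IH)
    show "integrable M ?W" by fact
    fix a :: "'t \<Rightarrow> real"
    let ?V = "\<lambda>\<omega>. W \<omega> * iexp (\<Sum>t\<in>T. a t * X t \<omega>)"
    have [measurable]: "(\<lambda>\<omega>. \<Sum>t\<in>T. a t * X t \<omega>) \<in> borel_measurable M"
      by (auto intro!: borel_measurable_sum borel_measurable_times mX)
    have iV: "integrable M ?V"
      by (rule Bochner_Integration.integrable_bound[OF insert.prems(1)]) (auto simp: norm_mult simp del: of_real_sum)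
    have "(CLINT \<omega>|M. ?V \<omega> * of_real (indicat_real (A t) (X t \<omega>))) = 0"
    proof (rule integral_eq_0_of_fourier_transform[OF iV, where X = "X t" and h = "indicat_real (A t)"])
      fix s
      have "(CLINT \<omega>|M. ?V \<omega> * iexp (s * X t \<omega>)) =
        (CLINT \<omega>|M. W \<omega> * iexp (\<Sum>u\<in>insert t T. (a(t := s)) u * X u \<omega>))"
      proof (rule Bochner_Integration.integral_cong[OF refl])
        fix \<omega>
        have "(\<Sum>u\<in>insert t T. (a(t := s)) u * X u \<omega>) = (\<Sum>u\<in>T. a u * X u \<omega>) + s * X t \<omega>"
          using insert.hyps by (simp add: add.commute) (auto intro!: sum.cong)
        then show "?V \<omega> * iexp (s * X t \<omega>) = W \<omega> * iexp (\<Sum>u\<in>insert t T. (a(t := s)) u * X u \<omega>)"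
          by (simp only: of_real_add distrib_left exp_add mult.assoc)
      qed
      then show "(CLINT \<omega>|M. ?V \<omega> * iexp (s * X t \<omega>)) = 0"
        using insert.prems(3) by simp
      show "integrable M (\<lambda>\<omega>. ?V \<omega> * of_real (indicat_real (A t) (X t \<omega>)))"
        by (rule Bochner_Integration.integrable_bound[OF iV]) (auto simp: norm_mult indicator_def)
    qed simp_all
    then show "(CLINT \<omega>|M. ?W \<omega> * iexp (\<Sum>t\<in>T. a t * X t \<omega>)) = 0"
      by (simp only: mult_ac)
  qed (use insert.prems in auto)
  moreover have "?W \<omega> * of_bool (\<forall>t\<in>T. X t \<omega> \<in> A t) = W \<omega> * of_bool (\<forall>u\<in>insert t T. X u \<omega> \<in> A u)" for \<omega>
    by (auto simp: indicator_def)
  ultimately show ?case by simp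
qed

text \<open>
  A factorising characteristic function implies independence of the event and \<open>V\<close>. Uniqueness is used
  twice: for the weight \<open>exp(i s V) - E exp(i s V)\<close> against the family \<open>U\<close>, and then for the centred
  indicator of the event against \<open>V\<close>.
\<close>

lemma (in prob_space) expectation_event_independent:
  fixes U :: "'t \<Rightarrow> 'a \<Rightarrow> real" and V :: "'a \<Rightarrow> real" and h :: "real \<Rightarrow> real"
  assumes T: "finite T" and U: "\<And>t. t \<in> T \<Longrightarrow> U t \<in> borel_measurable M" and V[measurable]: "V \<in> borel_measurable M"
    and F: "\<And>a s. (CLINT \<omega>|M. iexp (\<Sum>t\<in>T. a t * U t \<omega>) * iexp (s * V \<omega>)) =
              (CLINT \<omega>|M. iexp (\<Sum>t\<in>T. a t * U t \<omega>)) * (CLINT \<omega>|M. iexp (s * V \<omega>))"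
    and A: "\<And>t. t \<in> T \<Longrightarrow> A t \<in> sets borel"
    and h[measurable]: "h \<in> borel_measurable borel" and hV: "integrable M (\<lambda>\<omega>. h (V \<omega>))"
  shows "expectation (\<lambda>\<omega>. of_bool (\<forall>t\<in>T. U t \<omega> \<in> A t) * h (V \<omega>)) =
    expectation (\<lambda>\<omega>. of_bool (\<forall>t\<in>T. U t \<omega> \<in> A t)) * expectation (\<lambda>\<omega>. h (V \<omega>))"
proof -
  define B :: "'a \<Rightarrow> real" where "B = (\<lambda>\<omega>. of_bool (\<forall>t\<in>T. U t \<omega> \<in> A t))"
  have mP: "Measurable.pred M (\<lambda>\<omega>. \<forall>t\<in>T. U t \<omega> \<in> A t)"
  proof (rule pred_intros_finite)
    fix t assume "t \<in> T"
    then have [measurable]: "U t \<in> borel_measurable M" "A t \<in> sets borel" using U A by auto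
    show "Measurable.pred M (\<lambda>\<omega>. U t \<omega> \<in> A t)" by measurable
  qed (fact T)
  then have [measurable]: "B \<in> borel_measurable M" unfolding B_def of_bool_def by measurable
  have iB: "integrable M B" by (rule integrable_const_bound[of _ 1]) (simp add: B_def, measurable)
  have iX: "integrable M (\<lambda>\<omega>. iexp (Y \<omega>))" if "Y \<in> borel_measurable M" for Y
    using that by (intro integrable_const_bound[of _ 1]) auto
  have [measurable]: "(\<lambda>\<omega>. \<Sum>t\<in>T. a t * U t \<omega>) \<in> borel_measurable M" for a
    by (auto intro!: borel_measurable_sum borel_measurable_times U)
  have key: "(CLINT \<omega>|M. of_real (B \<omega> - expectation B) * iexp (s * V \<omega>)) = 0" for s
  proof -
    define \<phi> where "\<phi> = (CLINT \<omega>|M. iexp (s * V \<omega>))"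
    have iV: "integrable M (\<lambda>\<omega>. iexp (s * V \<omega>))" by (rule iX) simp
    have "(CLINT \<omega>|M. (iexp (s * V \<omega>) - \<phi>) * of_bool (\<forall>t\<in>T. U t \<omega> \<in> A t)) = 0"
    proof (rule integral_eq_0_of_fourier_transform_family[OF T])
      show "integrable M (\<lambda>\<omega>. iexp (s * V \<omega>) - \<phi>)" using iV by simp
      fix a
      let ?S = "\<lambda>\<omega>. \<Sum>t\<in>T. a t * U t \<omega>"
      have i1: "integrable M (\<lambda>\<omega>. iexp (?S \<omega>))" by (rule iX) measurable
      have i2: "integrable M (\<lambda>\<omega>. iexp (?S \<omega>) * iexp (s * V \<omega>))"
        by (rule Bochner_Integration.integrable_bound[OF i1])
           (auto simp: norm_mult simp del: of_real_sum of_real_mult)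
      have "(CLINT \<omega>|M. (iexp (s * V \<omega>) - \<phi>) * iexp (?S \<omega>)) =
          (CLINT \<omega>|M. iexp (?S \<omega>) * iexp (s * V \<omega>) - \<phi> * iexp (?S \<omega>))"
        by (intro Bochner_Integration.integral_cong refl) (simp only: algebra_simps)
      also have "\<dots> = (CLINT \<omega>|M. iexp (?S \<omega>) * iexp (s * V \<omega>)) - \<phi> * (CLINT \<omega>|M. iexp (?S \<omega>))"
        using i1 i2 by (simp del: of_real_sum of_real_mult)
      also have "\<dots> = 0" by (simp only: F \<phi>_def) simp
      finally show "(CLINT \<omega>|M. (iexp (s * V \<omega>) - \<phi>) * iexp (?S \<omega>)) = 0" .
    qed (use U A in auto)
    moreover have "(iexp (s * V \<omega>) - \<phi>) * of_bool (\<forall>t\<in>T. U t \<omega> \<in> A t) = of_real (B \<omega>) * iexp (s * V \<omega>) - of_real (B \<omega>) * \<phi>" for \<omega>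
      by (simp add: B_def)
    ultimately have "(CLINT \<omega>|M. of_real (B \<omega>) * iexp (s * V \<omega>) - of_real (B \<omega>) * \<phi>) = 0" by simp
    moreover have i3: "integrable M (\<lambda>\<omega>. of_real (B \<omega>) * iexp (s * V \<omega>))"
      by (rule Bochner_Integration.integrable_bound[OF iV]) (measurable, simp add: norm_mult B_def)
    ultimately have e1: "(CLINT \<omega>|M. of_real (B \<omega>) * iexp (s * V \<omega>)) = of_real (expectation B) * \<phi>"
      using iB by simp
    have "(CLINT \<omega>|M. of_real (B \<omega> - expectation B) * iexp (s * V \<omega>)) =
        (CLINT \<omega>|M. of_real (B \<omega>) * iexp (s * V \<omega>) - of_real (expectation B) * iexp (s * V \<omega>))"
      by (intro Bochner_Integration.integral_cong refl) (simp add: algebra_simps)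
    also have "\<dots> = (CLINT \<omega>|M. of_real (B \<omega>) * iexp (s * V \<omega>)) - of_real (expectation B) * \<phi>"
      using i3 iV unfolding \<phi>_def by (simp del: of_real_mult)
    finally show ?thesis using e1 by simp
  qed
  have iBh: "integrable M (\<lambda>\<omega>. B \<omega> * h (V \<omega>))"
    by (rule Bochner_Integration.integrable_bound[OF hV]) (measurable, simp add: B_def)
  have "(LINT \<omega>|M. (B \<omega> - expectation B) * h (V \<omega>)) = 0"
  proof (rule integral_eq_0_of_fourier_transform_real[where X = V and h = h])
    show "integrable M (\<lambda>\<omega>. B \<omega> - expectation B)" using iB by simp
    show "integrable M (\<lambda>\<omega>. (B \<omega> - expectation B) * h (V \<omega>))"
      using iBh hV by (simp add: left_diff_distrib)
  qed (use key in auto)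
  then show ?thesis using iBh hV by (simp add: left_diff_distrib B_def)
qed

section \<open>Rotations of two independent copies of a Gaussian family\<close>

lemma (in prob_space) prob_space_square: "prob_space (M \<Otimes>\<^sub>M M)"
proof -
  interpret P: pair_prob_space M M ..
  show ?thesis by (rule P.prob_space_axioms)
qed

lemma (in prob_space) integrable_fst_snd:
  fixes f :: "'a \<Rightarrow> 'b :: {banach, second_countable_topology}"
  assumes "integrable M f"
  shows "integrable (M \<Otimes>\<^sub>M M) (\<lambda>z. f (fst z))" "integrable (M \<Otimes>\<^sub>M M) (\<lambda>z. f (snd z))"
    "(LINT z|(M \<Otimes>\<^sub>M M). f (fst z)) = integral\<^sup>L M f" "(LINT z|(M \<Otimes>\<^sub>M M). f (snd z)) = integral\<^sup>L M f"
proof -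
  interpret P: pair_prob_space M M ..
  note [measurable] = borel_measurable_integrable[OF assms]
  have e: "distr (M \<Otimes>\<^sub>M M) M fst = M" by (rule distr_pair_fst)
  have "integrable (distr (M \<Otimes>\<^sub>M M) M fst) f" using assms by (simp add: e)
  then show 1: "integrable (M \<Otimes>\<^sub>M M) (\<lambda>z. f (fst z))"
    by (subst (asm) integrable_distr_eq) auto
  have "integrable (M \<Otimes>\<^sub>M M) (\<lambda>(x, y). f (fst (y, x)))"
    using P.integrable_product_swap[OF 1] by simp
  then show 2: "integrable (M \<Otimes>\<^sub>M M) (\<lambda>z. f (snd z))" by (simp add: case_prod_beta')
  show "(LINT z|(M \<Otimes>\<^sub>M M). f (fst z)) = integral\<^sup>L M f"
    using P.integral_fst'[OF 1] by (simp add: prob_space)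
  show "(LINT z|(M \<Otimes>\<^sub>M M). f (snd z)) = integral\<^sup>L M f"
    using P.integral_fst'[OF 2] by (simp add: prob_space)
qed

locale gaussian_family = prob_space M for M :: "'w measure" +
  fixes X :: "'t \<Rightarrow> 'w \<Rightarrow> real"
  assumes normal_combination: "finite T \<Longrightarrow> \<exists>v. centred_normal M v (\<lambda>\<omega>. \<Sum>t\<in>T. a t * X t \<omega>)"
begin

lemma combination_normal:
  assumes "finite T"
  shows "centred_normal M (expectation (\<lambda>\<omega>. (\<Sum>t\<in>T. a t * X t \<omega>)\<^sup>2)) (\<lambda>\<omega>. \<Sum>t\<in>T. a t * X t \<omega>)"
  using normal_combination[OF assms, of a] centred_normal_square(2) by auto

lemma combination_measurable[measurable]: "finite T \<Longrightarrow> (\<lambda>\<omega>. \<Sum>t\<in>T. a t * X t \<omega>) \<in> borel_measurable M"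
  using combination_normal centred_normal_measurable by blast

lemma combination_square_integrable: "finite T \<Longrightarrow> integrable M (\<lambda>\<omega>. (\<Sum>t\<in>T. a t * X t \<omega>)\<^sup>2)"
  using combination_normal centred_normal_square(1) by blast

lemma X_measurable[measurable]: "X t \<in> borel_measurable M"
  using combination_measurable[of "{t}" "\<lambda>_. 1"] by simp

lemma X_square_integrable: "integrable M (\<lambda>\<omega>. (X t \<omega>)\<^sup>2)"
  using combination_square_integrable[of "{t}" "\<lambda>_. 1"] by simp

lemma X_mult_integrable: "integrable M (\<lambda>\<omega>. X s \<omega> * X t \<omega>)"
proof (rule Bochner_Integration.integrable_bound)
  show "integrable M (\<lambda>\<omega>. (X s \<omega>)\<^sup>2 + (X t \<omega>)\<^sup>2)" by (simp add: X_square_integrable)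
  have "\<bar>x * y\<bar> \<le> x\<^sup>2 + y\<^sup>2" for x y :: real
  proof -
    have "0 \<le> (\<bar>x\<bar> - \<bar>y\<bar>)\<^sup>2" by simp
    also have "\<dots> = x\<^sup>2 + y\<^sup>2 - 2 * \<bar>x * y\<bar>"
      by (simp add: power2_diff abs_mult)
    finally show ?thesis using abs_ge_zero[of "x * y"] by linarith
  qed
  then show "AE \<omega> in M. norm (X s \<omega> * X t \<omega>) \<le> norm ((X s \<omega>)\<^sup>2 + (X t \<omega>)\<^sup>2)"
    by simp
qed simp

text \<open>
  The two projections of the product space turn \<open>X\<close> into two independent copies. The rotation by
  \<open>\<theta>\<close> interpolates between the first copy (\<open>\<theta> = 0\<close>) and the second one (\<open>\<theta> = \<pi>/2\<close>), and the
  derivative in \<open>\<theta>\<close> is the rotation by a further right angle.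
\<close>

definition rotation :: "real \<Rightarrow> 't \<Rightarrow> 'w \<times> 'w \<Rightarrow> real" where
  "rotation \<theta> t z = cos \<theta> * X t (fst z) + sin \<theta> * X t (snd z)"

lemma rotation_measurable[measurable]: "rotation \<theta> t \<in> borel_measurable (M \<Otimes>\<^sub>M M)"
  unfolding rotation_def by measurable

lemma rotation_0: "rotation 0 t z = X t (fst z)" and rotation_right_angle: "rotation (pi/2) t z = X t (snd z)"
  by (simp_all add: rotation_def)

lemma rotation_add: "rotation (\<theta> + h) t z = cos h * rotation \<theta> t z + sin h * rotation (\<theta> + pi/2) t z"
  by (simp add: rotation_def cos_add sin_add algebra_simps)

text \<open>
  Cauchy--Schwarz for the unit vector \<open>(cos \<theta>, sin \<theta>)\<close>. The factor 2 only affects the numerical constant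
  of the Poincare inequality.
\<close>

lemma rotation_square:
  "integrable (M \<Otimes>\<^sub>M M) (\<lambda>z. (rotation \<theta> t z)\<^sup>2)"
  "(LINT z|(M \<Otimes>\<^sub>M M). (rotation \<theta> t z)\<^sup>2) \<le> 2 * expectation (\<lambda>\<omega>. (X t \<omega>)\<^sup>2)"
proof -
  note i = integrable_fst_snd[OF X_square_integrable[of t]]
  have i': "integrable (M \<Otimes>\<^sub>M M) (\<lambda>z. (X t (fst z))\<^sup>2 + (X t (snd z))\<^sup>2)"
    using i by simp
  have le: "(rotation \<theta> t z)\<^sup>2 \<le> (X t (fst z))\<^sup>2 + (X t (snd z))\<^sup>2" for z
  proof -
    have "(rotation \<theta> t z)\<^sup>2 \<le> (rotation \<theta> t z)\<^sup>2 + (cos \<theta> * X t (snd z) - sin \<theta> * X t (fst z))\<^sup>2" by simp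
    also have "\<dots> = ((cos \<theta>)\<^sup>2 + (sin \<theta>)\<^sup>2) * ((X t (fst z))\<^sup>2 + (X t (snd z))\<^sup>2)"
      unfolding rotation_def by (simp only: power2_eq_square algebra_simps)
    finally show ?thesis by simp
  qed
  show 1: "integrable (M \<Otimes>\<^sub>M M) (\<lambda>z. (rotation \<theta> t z)\<^sup>2)"
    by (rule Bochner_Integration.integrable_bound[OF i']) (use le in auto)
  have "(LINT z|(M \<Otimes>\<^sub>M M). (rotation \<theta> t z)\<^sup>2) \<le> (LINT z|(M \<Otimes>\<^sub>M M). (X t (fst z))\<^sup>2 + (X t (snd z))\<^sup>2)"
    by (rule integral_mono[OF 1 i' le])
  also have "\<dots> = 2 * expectation (\<lambda>\<omega>. (X t \<omega>)\<^sup>2)"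
    using i by simp
  finally show "(LINT z|(M \<Otimes>\<^sub>M M). (rotation \<theta> t z)\<^sup>2) \<le> 2 * expectation (\<lambda>\<omega>. (X t \<omega>)\<^sup>2)" .
qed

text \<open>
  The exponent is \<open>A + B\<close> with \<open>A\<close> a combination of the first copy and \<open>B\<close> one of the second. In
  \<open>A\<^sup>2 + B\<^sup>2\<close> the mixed terms cancel because the two angles differ by a right angle; hence the variances
  split, and with them the characteristic function.
\<close>

lemma rotation_characteristic:
  assumes T: "finite T" and j: "j \<in> T"
  shows "(CLINT z|(M \<Otimes>\<^sub>M M). iexp (\<Sum>t\<in>T. a t * rotation \<theta> t z) * iexp (s * rotation (\<theta> + pi/2) j z)) =
    of_real (exp (- expectation (\<lambda>\<omega>. (\<Sum>t\<in>T. a t * X t \<omega>)\<^sup>2) / 2)) *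
    of_real (exp (- (s\<^sup>2 * expectation (\<lambda>\<omega>. (X j \<omega>)\<^sup>2)) / 2))"
proof -
  interpret P: pair_prob_space M M ..
  define L where "L = (\<lambda>\<omega>. \<Sum>t\<in>T. a t * X t \<omega>)"
  define b where "b = (\<lambda>t. cos \<theta> * a t - s * sin \<theta> * of_bool (t = j))"
  define c where "c = (\<lambda>t. sin \<theta> * a t + s * cos \<theta> * of_bool (t = j))"
  define A where "A = (\<lambda>\<omega>. \<Sum>t\<in>T. b t * X t \<omega>)"
  define B where "B = (\<lambda>\<omega>. \<Sum>t\<in>T. c t * X t \<omega>)"
  have mA[measurable]: "A \<in> borel_measurable M" "B \<in> borel_measurable M"
    unfolding A_def B_def using T by measurable
  have pick: "(\<Sum>t\<in>T. of_bool (t = j) * X t \<omega>) = X j \<omega>" for \<omega>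
    using T j by (simp add: of_bool_def if_distrib[of "\<lambda>x. x * _"] cong: if_cong)
  have A: "A \<omega> = cos \<theta> * L \<omega> - s * sin \<theta> * X j \<omega>" for \<omega>
    unfolding A_def b_def L_def pick[symmetric, of \<omega>]
    by (simp add: sum_distrib_left sum_subtractf left_diff_distrib mult.assoc)
  have B: "B \<omega> = sin \<theta> * L \<omega> + s * cos \<theta> * X j \<omega>" for \<omega>
    unfolding B_def c_def L_def pick[symmetric, of \<omega>]
    by (simp add: sum_distrib_left sum.distrib distrib_right mult.assoc)
  have cA: "(CLINT \<omega>|M. iexp (A \<omega>)) = of_real (exp (- expectation (\<lambda>\<omega>. (A \<omega>)\<^sup>2) / 2))"
    using centred_normal_iexp[OF combination_normal[OF T]] unfolding A_def by blast
  have cB: "(CLINT \<omega>|M. iexp (B \<omega>)) = of_real (exp (- expectation (\<lambda>\<omega>. (B \<omega>)\<^sup>2) / 2))"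
    using centred_normal_iexp[OF combination_normal[OF T]] unfolding B_def by blast
  have iA: "integrable M (\<lambda>\<omega>. (A \<omega>)\<^sup>2)" and iB: "integrable M (\<lambda>\<omega>. (B \<omega>)\<^sup>2)" and iL: "integrable M (\<lambda>\<omega>. (L \<omega>)\<^sup>2)"
    unfolding A_def B_def L_def by (rule combination_square_integrable[OF T])+
  have "(A \<omega>)\<^sup>2 + (B \<omega>)\<^sup>2 = ((cos \<theta>)\<^sup>2 + (sin \<theta>)\<^sup>2) * ((L \<omega>)\<^sup>2 + s\<^sup>2 * (X j \<omega>)\<^sup>2)" for \<omega>
    unfolding A B by (simp only: power2_eq_square algebra_simps)
  then have "expectation (\<lambda>\<omega>. (A \<omega>)\<^sup>2) + expectation (\<lambda>\<omega>. (B \<omega>)\<^sup>2) = expectation (\<lambda>\<omega>. (L \<omega>)\<^sup>2 + s\<^sup>2 * (X j \<omega>)\<^sup>2)"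
    using iA iB by (subst Bochner_Integration.integral_add[symmetric]) auto
  also have "\<dots> = expectation (\<lambda>\<omega>. (L \<omega>)\<^sup>2) + s\<^sup>2 * expectation (\<lambda>\<omega>. (X j \<omega>)\<^sup>2)"
    using iL X_square_integrable by simp
  finally have var: "expectation (\<lambda>\<omega>. (A \<omega>)\<^sup>2) + expectation (\<lambda>\<omega>. (B \<omega>)\<^sup>2) =
    expectation (\<lambda>\<omega>. (L \<omega>)\<^sup>2) + s\<^sup>2 * expectation (\<lambda>\<omega>. (X j \<omega>)\<^sup>2)" .
  have "(\<Sum>t\<in>T. a t * rotation \<theta> t z) + s * rotation (\<theta> + pi/2) j z = A (fst z) + B (snd z)" for z
    unfolding A B L_def rotation_def
    by (simp add: cos_add sin_add sum.distrib sum_distrib_left algebra_simps)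
  then have eq: "iexp (\<Sum>t\<in>T. a t * rotation \<theta> t z) * iexp (s * rotation (\<theta> + pi/2) j z) = iexp (A (fst z)) * iexp (B (snd z))" for z
    by (simp only: exp_add[symmetric] distrib_left[symmetric] of_real_add[symmetric])
  have int: "integrable (M \<Otimes>\<^sub>M M) (\<lambda>z. iexp (A (fst z)) * iexp (B (snd z)))"
    by (rule P.integrable_const_bound[of _ 1]) (auto simp: norm_mult)
  have "(CLINT z|(M \<Otimes>\<^sub>M M). iexp (A (fst z)) * iexp (B (snd z))) = (CLINT \<omega>|M. iexp (A \<omega>)) * (CLINT \<omega>|M. iexp (B \<omega>))"
    using P.integral_fst'[OF int] by simp
  also have "\<dots> = of_real (exp (- (expectation (\<lambda>\<omega>. (A \<omega>)\<^sup>2) + expectation (\<lambda>\<omega>. (B \<omega>)\<^sup>2)) / 2))"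
    unfolding cA cB by (simp only: of_real_mult[symmetric] exp_add[symmetric]) (simp add: add_divide_distrib)
  also have "\<dots> = of_real (exp (- expectation (\<lambda>\<omega>. (L \<omega>)\<^sup>2) / 2)) * of_real (exp (- (s\<^sup>2 * expectation (\<lambda>\<omega>. (X j \<omega>)\<^sup>2)) / 2))"
    unfolding var by (simp only: of_real_mult[symmetric] exp_add[symmetric]) (simp add: add_divide_distrib)
  finally show ?thesis unfolding eq L_def .
qed

end

section \<open>Concentration of the maximum of a Gaussian family\<close>

text \<open>
  Ties are broken by the numbering \<open>e\<close>, so that exactly one index is selected. The condition is phrased
  through the differences \<open>u t - u j\<close> because each of them ranges over a fixed set: for a random \<open>u\<close>,
  the event that \<open>j\<close> is selected is then of the form treated by \<open>expectation_event_independent\<close>.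
\<close>

definition first_maximiser :: "('t \<Rightarrow> nat) \<Rightarrow> 't set \<Rightarrow> ('t \<Rightarrow> real) \<Rightarrow> 't \<Rightarrow> bool" where
  "first_maximiser e T u j \<longleftrightarrow> (\<forall>t\<in>T. u t - u j \<in> (if e t < e j then {..<0} else {..0}))"

lemma first_maximiser_ge: "first_maximiser e T u j \<Longrightarrow> t \<in> T \<Longrightarrow> u t \<le> u j"
  unfolding first_maximiser_def by (fastforce split: if_splits)

lemma first_maximiser_unique:
  assumes "inj_on e T" "i \<in> T" "j \<in> T" "first_maximiser e T u i" "first_maximiser e T u j"
  shows "i = j"
proof -
  have "u i = u j" using assms first_maximiser_ge by (metis order_antisym)
  then have "\<not> e i < e j" "\<not> e j < e i"
    using assms unfolding first_maximiser_def by (metis diff_self lessThan_iff less_irrefl)+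
  then show ?thesis using assms(1-3) by (auto simp: inj_on_def)
qed

lemma first_maximiser_exists:
  assumes "finite T" "T \<noteq> {}" "inj_on e T"
  obtains j where "j \<in> T" "first_maximiser e T u j" "Max (u ` T) = u j"
proof -
  let ?S = "{j \<in> T. \<forall>t\<in>T. u t \<le> u j}"
  have "Max (u ` T) \<in> u ` T" using assms by simp
  then obtain i where i: "i \<in> T" "Max (u ` T) = u i" by auto
  then have "i \<in> ?S" using assms(1) by (auto simp flip: i(2))
  then have "?S \<noteq> {}" "finite ?S" using assms by auto
  then obtain j where j: "j \<in> ?S" "\<And>k. k \<in> ?S \<Longrightarrow> e j \<le> e k"
    by (metis (no_types, lifting) arg_min_if_finite(1) arg_min_least)
  show ?thesis
  proof
    show "j \<in> T" using j by simp
    show "Max (u ` T) = u j" using i j \<open>i \<in> ?S\<close> by (auto intro: order_antisym)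
    show "first_maximiser e T u j"
      unfolding first_maximiser_def
    proof
      fix t assume t: "t \<in> T"
      have "u t < u j" if "e t < e j"
      proof (rule ccontr)
        assume "\<not> u t < u j"
        then have "t \<in> ?S" using j t by force
        then show False using j(2)[of t] that by simp
      qed
      then show "u t - u j \<in> (if e t < e j then {..<0} else {..0})" using j t by auto
    qed
  qed
qed

text \<open>
  The maximum increases by at least the increment at the old maximiser and by at most the increment
  at the new one.
\<close>

lemma Max_increment_square_le:
  fixes u w :: "'t \<Rightarrow> real"
  assumes T: "finite T" "T \<noteq> {}" "inj_on e T"
  shows "(Max (w ` T) - Max (u ` T))\<^sup>2 \<le>
    (\<Sum>j\<in>T. of_bool (first_maximiser e T u j) * (w j - u j)\<^sup>2) +
    (\<Sum>j\<in>T. of_bool (first_maximiser e T w j) * (w j - u j)\<^sup>2)"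
proof -
  obtain i where i: "i \<in> T" "first_maximiser e T u i" "Max (u ` T) = u i"
    using first_maximiser_exists[OF T] by metis
  obtain j where j: "j \<in> T" "first_maximiser e T w j" "Max (w ` T) = w j"
    using first_maximiser_exists[OF T] by metis
  have "(w i - u i)\<^sup>2 = of_bool (first_maximiser e T u i) * (w i - u i)\<^sup>2" using i by simp
  also have "\<dots> \<le> (\<Sum>j\<in>T. of_bool (first_maximiser e T u j) * (w j - u j)\<^sup>2)"
    using T i by (intro member_le_sum) auto
  finally have 1: "(w i - u i)\<^sup>2 \<le> (\<Sum>j\<in>T. of_bool (first_maximiser e T u j) * (w j - u j)\<^sup>2)" .
  have "(w j - u j)\<^sup>2 = of_bool (first_maximiser e T w j) * (w j - u j)\<^sup>2" using j by simp
  also have "\<dots> \<le> (\<Sum>j\<in>T. of_bool (first_maximiser e T w j) * (w j - u j)\<^sup>2)"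
    using T j by (intro member_le_sum) auto
  finally have 2: "(w j - u j)\<^sup>2 \<le> (\<Sum>j\<in>T. of_bool (first_maximiser e T w j) * (w j - u j)\<^sup>2)" .
  have "w i - u i \<le> w j - u i" "w j - u i \<le> w j - u j"
    using first_maximiser_ge[OF i(2) j(1)] first_maximiser_ge[OF j(2) i(1)] by auto
  then have "\<bar>w j - u i\<bar> \<le> \<bar>w i - u i\<bar> \<or> \<bar>w j - u i\<bar> \<le> \<bar>w j - u j\<bar>" by linarith
  then have "(w j - u i)\<^sup>2 \<le> (w i - u i)\<^sup>2 \<or> (w j - u i)\<^sup>2 \<le> (w j - u j)\<^sup>2"
    by (simp only: abs_le_square_iff)
  then have "(w j - u i)\<^sup>2 \<le> (w i - u i)\<^sup>2 + (w j - u j)\<^sup>2"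
    using zero_le_power2[of "w i - u i"] zero_le_power2[of "w j - u j"] by linarith
  then show ?thesis using 1 2 i j by simp
qed

context gaussian_family
begin

text \<open>
  The differences \<open>rotation \<theta> t - rotation \<theta> j\<close> are combinations of the family at angle \<open>\<theta>\<close>, which is
  independent of the family at angle \<open>\<theta> + \<pi>/2\<close>.
\<close>

lemma rotation_independent:
  assumes T: "finite T" "j \<in> T"
  shows "(LINT z|(M \<Otimes>\<^sub>M M). of_bool (first_maximiser e T (\<lambda>t. rotation \<theta> t z) j) * (rotation (\<theta> + pi/2) j z)\<^sup>2) =
    (LINT z|(M \<Otimes>\<^sub>M M). of_bool (first_maximiser e T (\<lambda>t. rotation \<theta> t z) j)) * (LINT z|(M \<Otimes>\<^sub>M M). (rotation (\<theta> + pi/2) j z)\<^sup>2)"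
proof -
  interpret P: prob_space "M \<Otimes>\<^sub>M M" by (rule prob_space_square)
  show ?thesis
    unfolding first_maximiser_def
  proof (rule P.expectation_event_independent[where h = "\<lambda>x. x\<^sup>2" and V = "rotation (\<theta> + pi/2) j", OF T(1)])
    fix a :: "'t \<Rightarrow> real" and s :: real
    define b where "b = (\<lambda>t. a t - of_bool (t = j) * sum a T)"
    have "(\<Sum>t\<in>T. a t * (rotation \<theta> t z - rotation \<theta> j z)) = (\<Sum>t\<in>T. b t * rotation \<theta> t z)" for z
    proof -
      have "(\<Sum>t\<in>T. of_bool (t = j) * sum a T * rotation \<theta> t z) = sum a T * rotation \<theta> j z"
        using T by (simp add: of_bool_def if_distrib[of "\<lambda>x. x * _"] cong: if_cong)
      then show ?thesis
        by (simp add: b_def left_diff_distrib right_diff_distrib sum_subtractf sum_distrib_right)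
    qed
    then have eq: "iexp (\<Sum>t\<in>T. a t * (rotation \<theta> t z - rotation \<theta> j z)) = iexp (\<Sum>t\<in>T. b t * rotation \<theta> t z)" for z
      by presburger
    note * = rotation_characteristic[OF T, of _ \<theta>]
    show "(CLINT z|(M \<Otimes>\<^sub>M M). iexp (\<Sum>t\<in>T. a t * (rotation \<theta> t z - rotation \<theta> j z)) * iexp (s * rotation (\<theta> + pi/2) j z)) =
      (CLINT z|(M \<Otimes>\<^sub>M M). iexp (\<Sum>t\<in>T. a t * (rotation \<theta> t z - rotation \<theta> j z))) * (CLINT z|(M \<Otimes>\<^sub>M M). iexp (s * rotation (\<theta> + pi/2) j z))"
      unfolding eq using *[of b s] *[of b 0] *[of "\<lambda>_. 0" s] by simp
  qed (use rotation_square in auto)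
qed

text \<open>
  The increment is \<open>(cos h - 1) rotation \<theta> + sin h rotation (\<theta> + \<pi>/2)\<close>. In the second term the selected
  index is independent of the increment, so summing over the indices costs the factor
  \<open>\<Sum>j. P(j selected) \<le> 1\<close> instead of the number of indices. The first term is estimated without using the
  selection; it carries that number, but with the small factor \<open>h\<^sup>4\<close>.
\<close>

lemma rotation_step:
  fixes \<theta> h :: real and e :: "'t \<Rightarrow> nat"
  assumes T: "finite T" "inj_on e T" "T \<noteq> {}" and v: "\<And>t. t \<in> T \<Longrightarrow> expectation (\<lambda>\<omega>. (X t \<omega>)\<^sup>2) \<le> v"
  defines "D \<equiv> \<lambda>z. \<Sum>j\<in>T. of_bool (first_maximiser e T (\<lambda>t. rotation \<theta> t z) j) * (rotation (\<theta> + h) j z - rotation \<theta> j z)\<^sup>2"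
  shows "integrable (M \<Otimes>\<^sub>M M) D" and "(LINT z|(M \<Otimes>\<^sub>M M). D z) \<le> (h^4 * card T + 4 * h\<^sup>2) * v"
proof -
  interpret P: prob_space "M \<Otimes>\<^sub>M M" by (rule prob_space_square)
  define G where "G = (\<lambda>j z. of_bool (first_maximiser e T (\<lambda>t. rotation \<theta> t z) j) :: real)"
  have G01: "0 \<le> G j z" "G j z \<le> 1" for j z by (auto simp: G_def)
  have "Measurable.pred (M \<Otimes>\<^sub>M M) (\<lambda>z. first_maximiser e T (\<lambda>t. rotation \<theta> t z) j)" for j
    unfolding first_maximiser_def
    by (rule pred_intros_finite[OF T(1)]) (auto split: if_splits)
  then have [measurable]: "G j \<in> borel_measurable (M \<Otimes>\<^sub>M M)" for j
    unfolding G_def of_bool_def by measurable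
  have iG: "integrable (M \<Otimes>\<^sub>M M) (G j)" for j
    by (rule P.integrable_const_bound[of _ 1]) (use G01 in auto)
  have iGr: "integrable (M \<Otimes>\<^sub>M M) (\<lambda>z. G j z * (rotation \<phi> j z)\<^sup>2)" for j \<phi>
    by (rule Bochner_Integration.integrable_bound[OF rotation_square(1)[of \<phi> j]])
      (measurable, simp add: G_def)
  have sumG: "(\<Sum>j\<in>T. G j z) \<le> 1" for z
  proof (cases "\<exists>j\<in>T. first_maximiser e T (\<lambda>t. rotation \<theta> t z) j")
    case True
    then obtain j where "j \<in> T" "first_maximiser e T (\<lambda>t. rotation \<theta> t z) j" by auto
    then have "(\<Sum>i\<in>T. G i z) = (\<Sum>i\<in>T. of_bool (i = j))"
      unfolding G_def using first_maximiser_unique[OF T(2)] by (intro sum.cong) auto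
    then show ?thesis using T \<open>j \<in> T\<close> by (simp add: of_bool_def)
  next
    case False
    then show ?thesis by (simp add: G_def)
  qed
  have sumEG: "(\<Sum>j\<in>T. (LINT z|(M \<Otimes>\<^sub>M M). G j z)) \<le> 1"
  proof -
    have "(\<Sum>j\<in>T. (LINT z|(M \<Otimes>\<^sub>M M). G j z)) = (LINT z|(M \<Otimes>\<^sub>M M). (\<Sum>j\<in>T. G j z))"
      using iG by simp
    also have "\<dots> \<le> (LINT z|(M \<Otimes>\<^sub>M M). 1)"
      by (rule integral_mono) (use iG sumG in auto)
    finally show ?thesis by (simp add: P.prob_space)
  qed
  have cosh: "(1 - cos h)\<^sup>2 \<le> h^4 / 4"
  proof -
    have "(1 - cos h)\<^sup>2 \<le> (h\<^sup>2 / 2)\<^sup>2" by (rule power_mono) (use one_minus_cos_le in auto)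
    then show ?thesis by (simp add: power_divide flip: power_mult)
  qed
  have sinh: "(sin h)\<^sup>2 \<le> h\<^sup>2" using abs_sin_x_le_abs_x[of h] by (simp only: abs_le_square_iff)
  define E where "E = (\<lambda>z. \<Sum>j\<in>T. h^4 / 2 * (rotation \<theta> j z)\<^sup>2 + 2 * h\<^sup>2 * (G j z * (rotation (\<theta> + pi/2) j z)\<^sup>2))"
  have iE: "integrable (M \<Otimes>\<^sub>M M) E"
    unfolding E_def by (intro Bochner_Integration.integrable_sum Bochner_Integration.integrable_add integrable_mult_right rotation_square iGr)
  have summand: "G j z * (rotation (\<theta> + h) j z - rotation \<theta> j z)\<^sup>2 \<le>
    h^4 / 2 * (rotation \<theta> j z)\<^sup>2 + 2 * h\<^sup>2 * (G j z * (rotation (\<theta> + pi/2) j z)\<^sup>2)" for j z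
  proof -
    let ?r = "rotation \<theta> j z" and ?q = "rotation (\<theta> + pi/2) j z"
    have "(rotation (\<theta> + h) j z - ?r)\<^sup>2 = (- ((1 - cos h) * ?r) + sin h * ?q)\<^sup>2"
      unfolding rotation_add[of \<theta> h] by (simp add: algebra_simps)
    also have "\<dots> \<le> 2 * ((1 - cos h) * ?r)\<^sup>2 + 2 * (sin h * ?q)\<^sup>2"
    proof -
      have "(- a + b)\<^sup>2 \<le> 2 * a\<^sup>2 + 2 * b\<^sup>2" for a b :: real
        using zero_le_power2[of "a + b"] by (simp add: power2_eq_square algebra_simps)
      then show ?thesis .
    qed
    also have "\<dots> \<le> 2 * (h^4 / 4 * ?r\<^sup>2) + 2 * (h\<^sup>2 * ?q\<^sup>2)"
      unfolding power_mult_distrib by (intro add_mono mult_left_mono mult_right_mono cosh sinh) auto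
    finally have *: "(rotation (\<theta> + h) j z - ?r)\<^sup>2 \<le> h^4 / 2 * ?r\<^sup>2 + 2 * h\<^sup>2 * ?q\<^sup>2" by simp
    show ?thesis
    proof (cases "G j z = 1")
      case True
      then show ?thesis using * by simp
    next
      case False
      then have "G j z = 0" by (auto simp: G_def)
      then show ?thesis by simp
    qed
  qed
  have DE: "D z \<le> E z" for z
    unfolding D_def E_def using summand by (intro sum_mono) (auto simp: G_def)
  have D0: "D z \<ge> 0" for z unfolding D_def by (intro sum_nonneg) auto
  have "D = (\<lambda>z. \<Sum>j\<in>T. G j z * (rotation (\<theta> + h) j z - rotation \<theta> j z)\<^sup>2)"
    by (simp add: D_def G_def)
  then have [measurable]: "D \<in> borel_measurable (M \<Otimes>\<^sub>M M)" by simp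
  show iD: "integrable (M \<Otimes>\<^sub>M M) D"
    by (rule Bochner_Integration.integrable_bound[OF iE]) (measurable, rule AE_I2, use D0 order_trans[OF DE abs_ge_self] in simp)
  have "(LINT z|(M \<Otimes>\<^sub>M M). D z) \<le> (LINT z|(M \<Otimes>\<^sub>M M). E z)"
    by (rule integral_mono[OF iD iE DE])
  also have "\<dots> = (\<Sum>j\<in>T. h^4 / 2 * (LINT z|(M \<Otimes>\<^sub>M M). (rotation \<theta> j z)\<^sup>2) +
      2 * h\<^sup>2 * (LINT z|(M \<Otimes>\<^sub>M M). G j z * (rotation (\<theta> + pi/2) j z)\<^sup>2))"
    unfolding E_def using rotation_square(1) iGr by (subst Bochner_Integration.integral_sum) auto
  also have "\<dots> \<le> (\<Sum>j\<in>T. h^4 / 2 * (2 * v) + 2 * h\<^sup>2 * ((LINT z|(M \<Otimes>\<^sub>M M). G j z) * (2 * v)))"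
  proof (rule sum_mono)
    fix j assume j: "j \<in> T"
    have b: "(LINT z|(M \<Otimes>\<^sub>M M). (rotation \<phi> j z)\<^sup>2) \<le> 2 * v" for \<phi>
      using rotation_square(2)[of \<phi> j] v[OF j] by linarith
    have "(LINT z|(M \<Otimes>\<^sub>M M). G j z * (rotation (\<theta> + pi/2) j z)\<^sup>2) =
       (LINT z|(M \<Otimes>\<^sub>M M). G j z) * (LINT z|(M \<Otimes>\<^sub>M M). (rotation (\<theta> + pi/2) j z)\<^sup>2)"
      unfolding G_def by (rule rotation_independent[OF T(1) j])
    also have "\<dots> \<le> (LINT z|(M \<Otimes>\<^sub>M M). G j z) * (2 * v)"
      by (intro mult_left_mono b integral_nonneg) (simp add: G01)
    finally show "h^4 / 2 * (LINT z|(M \<Otimes>\<^sub>M M). (rotation \<theta> j z)\<^sup>2) +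
      2 * h\<^sup>2 * (LINT z|(M \<Otimes>\<^sub>M M). G j z * (rotation (\<theta> + pi/2) j z)\<^sup>2) \<le>
      h^4 / 2 * (2 * v) + 2 * h\<^sup>2 * ((LINT z|(M \<Otimes>\<^sub>M M). G j z) * (2 * v))"
      by (intro add_mono mult_left_mono b) auto
  qed
  also have "\<dots> = h^4 * card T * v + 4 * h\<^sup>2 * v * (\<Sum>j\<in>T. (LINT z|(M \<Otimes>\<^sub>M M). G j z))"
    by (simp add: sum.distrib sum_distrib_left sum_distrib_right algebra_simps)
  also have "\<dots> \<le> (h^4 * card T + 4 * h\<^sup>2) * v"
  proof -
    obtain t where "t \<in> T" using T by auto
    have "0 \<le> expectation (\<lambda>\<omega>. (X t \<omega>)\<^sup>2)" by simp
    then have "0 \<le> v" using v[OF \<open>t \<in> T\<close>] by linarith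
    then have "4 * h\<^sup>2 * v * (\<Sum>j\<in>T. (LINT z|(M \<Otimes>\<^sub>M M). G j z)) \<le> 4 * h\<^sup>2 * v * 1"
      by (intro mult_left_mono sumEG) auto
    then show ?thesis by (simp add: distrib_right)
  qed
  finally show "(LINT z|(M \<Otimes>\<^sub>M M). D z) \<le> (h^4 * card T + 4 * h\<^sup>2) * v" .
qed

text \<open>
  A Poincare inequality whose constant does not depend on the number of variables. The right angle is
  divided into \<open>n = card T\<close> steps of size \<open>h\<close>. Cauchy--Schwarz over the steps gives \<open>n\<^sup>2\<close> times the bound
  of a single step; since \<open>n h = \<pi>/2\<close>, the main term stays bounded, and \<open>h\<^sup>2 card T \<le> 4\<close> makes the error
  term harmless.
\<close>

lemma expectation_Max_diff_square:
  assumes T: "finite T" "T \<noteq> {}" and v: "\<And>t. t \<in> T \<Longrightarrow> expectation (\<lambda>\<omega>. (X t \<omega>)\<^sup>2) \<le> v"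
  defines "F \<equiv> \<lambda>\<omega>. Max ((\<lambda>t. X t \<omega>) ` T)"
  shows "integrable (M \<Otimes>\<^sub>M M) (\<lambda>z. (F (snd z) - F (fst z))\<^sup>2)"
    and "(LINT z|(M \<Otimes>\<^sub>M M). (F (snd z) - F (fst z))\<^sup>2) \<le> 4 * pi\<^sup>2 * v"
proof -
  obtain e :: "'t \<Rightarrow> nat" where e: "inj_on e T"
    using finite_imp_inj_to_nat_seg[OF T(1)] by metis
  obtain t where "t \<in> T" using T by auto
  have "0 \<le> expectation (\<lambda>\<omega>. (X t \<omega>)\<^sup>2)" by simp
  then have v0: "0 \<le> v" using v[OF \<open>t \<in> T\<close>] by linarith
  define n where "n = card T"
  have n: "1 \<le> n" using T by (simp add: n_def Suc_le_eq card_gt_0_iff)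
  define h where "h = pi / (2 * n)"
  define R where "R = (\<lambda>k::nat. \<lambda>z. Max ((\<lambda>t. rotation (k * h) t z) ` T))"
  have Rm[measurable]: "R k \<in> borel_measurable (M \<Otimes>\<^sub>M M)" for k
    unfolding R_def using T by measurable
  define D where "D = (\<lambda>\<theta> h z. \<Sum>j\<in>T. of_bool (first_maximiser e T (\<lambda>t. rotation \<theta> t z) j) * (rotation (\<theta> + h) j z - rotation \<theta> j z)\<^sup>2)"
  have D: "integrable (M \<Otimes>\<^sub>M M) (D \<theta> h)" "(LINT z|(M \<Otimes>\<^sub>M M). D \<theta> h z) \<le> (h^4 * card T + 4 * h\<^sup>2) * v" for \<theta> h
    unfolding D_def by (rule rotation_step[OF T(1) e T(2) v]; assumption)+
  have step: "(R (Suc k) z - R k z)\<^sup>2 \<le> D (k * h) h z + D (Suc k * h) (- h) z" for k z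
  proof -
    have *: "k * h + h = Suc k * h" "Suc k * h + - h = k * h" by (auto simp: algebra_simps)
    show ?thesis
      using Max_increment_square_le[OF T e, of "\<lambda>t. rotation (Suc k * h) t z" "\<lambda>t. rotation (k * h) t z"]
      unfolding R_def D_def * by (simp only: power2_commute[of "rotation (k * h) _ z"])
  qed
  have iD: "integrable (M \<Otimes>\<^sub>M M) (\<lambda>z. D (k * h) h z + D (Suc k * h) (- h) z)" for k
    using D(1) by simp
  have iR: "integrable (M \<Otimes>\<^sub>M M) (\<lambda>z. (R (Suc k) z - R k z)\<^sup>2)" for k
    by (rule Bochner_Integration.integrable_bound[OF iD[of k]])
      (measurable, rule AE_I2, use order_trans[OF step abs_ge_self] in simp)
  have Es: "(LINT z|(M \<Otimes>\<^sub>M M). (R (Suc k) z - R k z)\<^sup>2) \<le> 2 * ((h^4 * n + 4 * h\<^sup>2) * v)" for k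
  proof -
    have "(LINT z|(M \<Otimes>\<^sub>M M). (R (Suc k) z - R k z)\<^sup>2) \<le> (LINT z|(M \<Otimes>\<^sub>M M). D (k * h) h z + D (Suc k * h) (- h) z)"
      by (rule integral_mono[OF iR iD step])
    also have "\<dots> = (LINT z|(M \<Otimes>\<^sub>M M). D (k * h) h z) + (LINT z|(M \<Otimes>\<^sub>M M). D (Suc k * h) (- h) z)"
      using D(1) by simp
    also have "\<dots> \<le> 2 * ((h^4 * n + 4 * h\<^sup>2) * v)"
      using D(2)[of "k * h" h] D(2)[of "Suc k * h" "- h"] by (simp add: n_def)
    finally show ?thesis .
  qed
  have R0: "R 0 z = F (fst z)" and Rn: "R n z = F (snd z)" for z
  proof -
    show "R 0 z = F (fst z)" by (simp add: R_def F_def rotation_0)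
    have "n * h = pi / 2" using n by (simp add: h_def)
    then show "R n z = F (snd z)" unfolding R_def F_def by (simp only: rotation_right_angle)
  qed
  have le: "(F (snd z) - F (fst z))\<^sup>2 \<le> (\<Sum>k<n. (R (Suc k) z - R k z)\<^sup>2) * n" for z
  proof -
    have "F (snd z) - F (fst z) = (\<Sum>k<n. R (Suc k) z - R k z)"
      using sum_lessThan_telescope[of "\<lambda>k. R k z" n] by (simp only: R0 Rn)
    then show ?thesis using sum_squared_le_sum_of_squares[of "\<lambda>k. R (Suc k) z - R k z" "{..<n}"] by simp
  qed
  have iS: "integrable (M \<Otimes>\<^sub>M M) (\<lambda>z. (\<Sum>k<n. (R (Suc k) z - R k z)\<^sup>2) * n)"
    using iR by simp
  have [measurable]: "(\<lambda>z. F (fst z)) \<in> borel_measurable (M \<Otimes>\<^sub>M M)" "(\<lambda>z. F (snd z)) \<in> borel_measurable (M \<Otimes>\<^sub>M M)"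
    using Rm[of 0] Rm[of n] by (simp_all add: R0[abs_def] Rn[abs_def] cong: measurable_cong)
  show iF: "integrable (M \<Otimes>\<^sub>M M) (\<lambda>z. (F (snd z) - F (fst z))\<^sup>2)"
    by (rule Bochner_Integration.integrable_bound[OF iS]) (measurable, rule AE_I2, use order_trans[OF le abs_ge_self] in simp)
  have "(LINT z|(M \<Otimes>\<^sub>M M). (F (snd z) - F (fst z))\<^sup>2) \<le> (LINT z|(M \<Otimes>\<^sub>M M). (\<Sum>k<n. (R (Suc k) z - R k z)\<^sup>2) * n)"
    by (rule integral_mono[OF iF iS le])
  also have "\<dots> = (\<Sum>k<n. (LINT z|(M \<Otimes>\<^sub>M M). (R (Suc k) z - R k z)\<^sup>2)) * n"
    using iR by simp
  also have "\<dots> \<le> (\<Sum>k<n. 2 * ((h^4 * n + 4 * h\<^sup>2) * v)) * n"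
    by (intro mult_right_mono sum_mono Es) auto
  also have "\<dots> = 2 * (n * h)\<^sup>2 * (h\<^sup>2 * n + 4) * v"
    by (simp add: power2_eq_square power4_eq_xxxx algebra_simps)
  also have "\<dots> = pi\<^sup>2 / 2 * (h\<^sup>2 * n + 4) * v"
    using n by (simp add: h_def power_divide)
  also have "\<dots> \<le> pi\<^sup>2 / 2 * (4 + 4) * v"
  proof -
    have "h\<^sup>2 * n = pi\<^sup>2 / (4 * n)" using n by (simp add: h_def power2_eq_square field_simps)
    also have "\<dots> \<le> 4\<^sup>2 / (4 * 1)"
      using pi_less_4 n by (intro frac_le power_mono) auto
    finally show ?thesis using v0 by (intro mult_right_mono mult_left_mono add_mono) auto
  qed
  finally show "(LINT z|(M \<Otimes>\<^sub>M M). (F (snd z) - F (fst z))\<^sup>2) \<le> 4 * pi\<^sup>2 * v" by simp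
qed

text \<open>
  Chebyshev's inequality for the difference of two independent copies of the maximum. It compares two
  levels directly, so neither the mean nor the median of the maximum has to be located.
\<close>

lemma prob_Max_levels:
  assumes T: "finite T" "T \<noteq> {}" and v: "\<And>t. t \<in> T \<Longrightarrow> expectation (\<lambda>\<omega>. (X t \<omega>)\<^sup>2) \<le> v" and "a < b"
  shows "prob {\<omega> \<in> space M. \<forall>t\<in>T. X t \<omega> < a} * prob {\<omega> \<in> space M. \<exists>t\<in>T. b \<le> X t \<omega>} \<le> 4 * pi\<^sup>2 * v / (b - a)\<^sup>2"
proof -
  interpret P: pair_prob_space M M ..
  define F where "F = (\<lambda>\<omega>. Max ((\<lambda>t. X t \<omega>) ` T))"
  have F: "integrable (M \<Otimes>\<^sub>M M) (\<lambda>z. (F (snd z) - F (fst z))\<^sup>2)"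
    "(LINT z|(M \<Otimes>\<^sub>M M). (F (snd z) - F (fst z))\<^sup>2) \<le> 4 * pi\<^sup>2 * v"
    unfolding F_def by (rule expectation_Max_diff_square[OF T v]; assumption)+
  let ?A = "{\<omega> \<in> space M. \<forall>t\<in>T. X t \<omega> < a}" and ?B = "{\<omega> \<in> space M. \<exists>t\<in>T. b \<le> X t \<omega>}"
  have [measurable]: "?A \<in> sets M" "?B \<in> sets M" using T by measurable
  have i: "integrable (M \<Otimes>\<^sub>M M) (\<lambda>z. indicat_real ?A (fst z) * indicat_real ?B (snd z))"
    by (rule P.integrable_const_bound[of _ 1]) (auto simp: indicator_def)
  have "prob ?A * prob ?B = (LINT z|(M \<Otimes>\<^sub>M M). indicat_real ?A (fst z) * indicat_real ?B (snd z))"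
    using P.integral_fst'[OF i] by simp
  also have "\<dots> \<le> (LINT z|(M \<Otimes>\<^sub>M M). (F (snd z) - F (fst z))\<^sup>2 / (b - a)\<^sup>2)"
  proof (rule integral_mono[OF i])
    show "integrable (M \<Otimes>\<^sub>M M) (\<lambda>z. (F (snd z) - F (fst z))\<^sup>2 / (b - a)\<^sup>2)" using F by simp
    fix z
    show "indicat_real ?A (fst z) * indicat_real ?B (snd z) \<le> (F (snd z) - F (fst z))\<^sup>2 / (b - a)\<^sup>2"
    proof (cases "fst z \<in> ?A \<and> snd z \<in> ?B")
      case True
      then have "F (fst z) < a" "b \<le> F (snd z)"
        unfolding F_def using T by (auto simp: Max_ge_iff)
      then have "(b - a)\<^sup>2 \<le> (F (snd z) - F (fst z))\<^sup>2" using \<open>a < b\<close> by (intro power_mono) auto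
      then show ?thesis using True \<open>a < b\<close> by simp
    qed (auto simp: indicator_def)
  qed
  also have "\<dots> \<le> 4 * pi\<^sup>2 * v / (b - a)\<^sup>2"
    using F(2) by (simp add: divide_right_mono)
  finally show ?thesis .
qed

end

section \<open>Stationary Gaussian processes: no high peaks\<close>

lemma summable_exp_neg_square:
  assumes c: "0 < c"
  shows "summable (\<lambda>n::nat. exp (- (real n)\<^sup>2 / c))"
proof (rule summable_comparison_test'[where N = 1])
  show "norm (exp (- (real n)\<^sup>2 / c)) \<le> c * inverse (real n ^ 2)" if "1 \<le> n" for n :: nat
  proof -
    have "(real n)\<^sup>2 / c \<le> exp ((real n)\<^sup>2 / c)" using exp_ge_add_one_self[of "(real n)\<^sup>2 / c"] by linarith
    then show ?thesis using c that by (simp add: exp_minus field_simps)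
  qed
  show "summable (\<lambda>n::nat. c * inverse (real n ^ 2))"
    by (rule summable_mult) (rule inverse_power_summable, simp)
qed

locale stationary_gaussian = gaussian_family M X for M :: "'w measure" and X :: "real \<Rightarrow> 'w \<Rightarrow> real" +
  fixes K :: "real \<Rightarrow> real"
  assumes covariance: "expectation (\<lambda>\<omega>. X s \<omega> * X t \<omega>) = K (t - s)"
    and variance_pos: "0 < K 0"
    and smooth: "AE \<omega> in M. C2_smooth (\<lambda>t. X t \<omega>)"
    and decay: "((\<lambda>t. K t * ln t) \<longlongrightarrow> 0) at_top"
begin

lemma K_minus: "K (- t) = K t"
  using covariance[of 0 t] covariance[of t 0] by (simp add: mult.commute)

lemma two_point_normal:
  "centred_normal M (a\<^sup>2 * K 0 + b\<^sup>2 * K 0 + 2 * a * b * K (t - s)) (\<lambda>\<omega>. a * X s \<omega> + b * X t \<omega>)"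
proof -
  have "centred_normal M (expectation (\<lambda>\<omega>. (a * X s \<omega> + b * X t \<omega>)\<^sup>2)) (\<lambda>\<omega>. a * X s \<omega> + b * X t \<omega>)"
  proof (cases "s = t")
    case True
    then show ?thesis using combination_normal[of "{t}" "\<lambda>_. a + b"] by (simp add: distrib_right)
  next
    case False
    then show ?thesis using combination_normal[of "{s, t}" "\<lambda>u. if u = s then a else b"] by simp
  qed
  moreover have "expectation (\<lambda>\<omega>. (a * X s \<omega> + b * X t \<omega>)\<^sup>2) = a\<^sup>2 * K 0 + b\<^sup>2 * K 0 + 2 * a * b * K (t - s)"
  proof -
    have "(\<lambda>\<omega>. (a * X s \<omega> + b * X t \<omega>)\<^sup>2) =
      (\<lambda>\<omega>. a\<^sup>2 * (X s \<omega> * X s \<omega>) + b\<^sup>2 * (X t \<omega> * X t \<omega>) + 2 * a * b * (X s \<omega> * X t \<omega>))"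
      by (auto simp: power2_eq_square algebra_simps)
    then show ?thesis using X_mult_integrable by (simp add: covariance)
  qed
  ultimately show ?thesis by simp
qed

lemma X_normal: "centred_normal M (K 0) (X t)"
  using two_point_normal[of 1 0 t t] by simp

lemma increment_normal: "centred_normal M (2 * (K 0 - K h)) (\<lambda>\<omega>. X (t + h) \<omega> - X t \<omega>)"
  using two_point_normal[of "-1" 1 "t + h" t] by (simp add: algebra_simps)

lemma variance: "expectation (\<lambda>\<omega>. (X t \<omega>)\<^sup>2) = K 0"
  using centred_normal_square(2)[OF X_normal] .

text \<open>
  The rescaled increments \<open>2\<^sup>q (X(2\<^sup>-\<^sup>q) - X(0))\<close> converge to the derivative at 0, so their variances are
  bounded.
\<close>

lemma dyadic_increment_variance:
  obtains L where "0 < L" "\<And>q::nat. 2 * (K 0 - K (1 / 2^q)) \<le> L / 4^q"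
proof -
  define Y where "Y = (\<lambda>q::nat. \<lambda>\<omega>. 2^q * (X (0 + 1 / 2^q) \<omega> - X 0 \<omega>))"
  have "AE \<omega> in M. bounded (range (\<lambda>q. Y q \<omega>))"
    using smooth
  proof eventually_elim
    case (elim \<omega>)
    then obtain h' where "\<And>t. ((\<lambda>t. X t \<omega>) has_real_derivative h' t) (at t)"
      unfolding C2_smooth_def by blast
    from this[of 0] have lim: "((\<lambda>h. (X (0 + h) \<omega> - X 0 \<omega>) / h) \<longlongrightarrow> h' 0) (at 0)"
      unfolding DERIV_def .
    have "(\<lambda>q. 1 / 2^q :: real) \<longlonglongrightarrow> 0"
      by (rule LIMSEQ_divide_realpow_zero) simp
    then have "filterlim (\<lambda>q::nat. 1 / 2^q :: real) (at 0) sequentially"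
      unfolding filterlim_at by simp
    then have "(\<lambda>q. (X (0 + 1 / 2^q) \<omega> - X 0 \<omega>) / (1 / 2^q)) \<longlonglongrightarrow> h' 0"
      by (rule filterlim_compose[OF lim])
    then have "(\<lambda>q. Y q \<omega>) \<longlonglongrightarrow> h' 0" by (simp add: Y_def mult.commute)
    then show ?case by (intro convergent_imp_bounded) (auto simp: convergent_def)
  qed
  moreover have "centred_normal M ((2^q)\<^sup>2 * (2 * (K 0 - K (1 / 2^q)))) (Y q)" for q
    unfolding Y_def by (rule centred_normal_scale[OF increment_normal])
  ultimately obtain C where C: "0 < C" "\<And>q::nat. (2^q)\<^sup>2 * (2 * (K 0 - K (1 / 2^q))) \<le> C"
    using centred_normal_variances_bounded[of "\<lambda>q. (2^q)\<^sup>2 * (2 * (K 0 - K (1 / 2^q)))" Y] by blast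
  have "((2::real)^q)\<^sup>2 = 4^q" for q by (simp add: power2_eq_square flip: power_mult_distrib)
  then have "2 * (K 0 - K (1 / 2^q)) \<le> C / 4^q" for q using C(2)[of q] by (simp add: field_simps)
  then show ?thesis using that C(1) by blast
qed

text \<open>
  Only levels from some \<open>p\<close> on are mentioned; every dyadic number is of this form.
\<close>

definition dyadic_bound_off :: "real \<Rightarrow> 'w set \<Rightarrow> bool" where
  "dyadic_bound_off R B \<longleftrightarrow> (\<exists>p. \<forall>\<omega>\<in>space M - B. \<forall>j k.
     real k / 2^(p+j) \<le> exp (R\<^sup>2 / (2 * K 0)) \<longrightarrow> X (real k / 2^(p+j)) \<omega> \<le> 11/10 * R)"

text \<open>
  Chaining. On the grid of mesh \<open>2\<^sup>-\<^sup>p\<close> the level \<open>21/20 R\<close> is not exceeded except on an event \<open>A\<close> of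
  small probability: there are about \<open>2\<^sup>p exp(\<Lambda>/2)\<close> points, each exceeding it with probability
  at most \<open>exp(-(21/20)\<^sup>2 \<Lambda>/2)\<close>, where \<open>\<Lambda> = R\<^sup>2 / K(0)\<close>. The remaining allowance \<open>R/20\<close> is spent on refining the
  grid: passing from level \<open>p + j\<close> to \<open>p + j + 1\<close> may add \<open>u j = R/80 (3/4)\<^sup>j\<close>, and these numbers sum
  to \<open>R/20\<close>. The ratio 3/4 exceeds 1/2, the rate at which the standard deviations of the increments
  decay; so the exceptional probabilities \<open>D j\<close> decay faster than the number of increments grows. The
  mesh is chosen fine enough for this to work from \<open>j = 0\<close> on.
\<close>

lemma dyadic_bound_off_small_event:
  "\<exists>C>0. \<forall>R>0. 2 * K 0 \<le> R\<^sup>2 \<longrightarrow>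
     (\<exists>B\<in>events. prob B \<le> C * exp (- R\<^sup>2 / (20 * K 0)) \<and> dyadic_bound_off R B)"
proof -
  obtain L where L: "0 < L" "\<And>q::nat. 2 * (K 0 - K (1 / 2^q)) \<le> L / 4^q"
    using dyadic_increment_variance by blast
  \<comment> \<open>The constant \<open>12800 = 2 \<cdot> 80\<^sup>2\<close> comes from \<open>u j = R/80 (3/4)\<^sup>j\<close> in the tail bound for increments.\<close>
  obtain p :: nat where "12800 * L / K 0 < 4^p"
    using real_arch_pow[of 4 "12800 * L / K 0"] by auto
  then have p: "12800 * L \<le> 4^p * K 0" using variance_pos by (simp add: divide_less_eq)
  show ?thesis
  proof (rule exI[of _ "12 * 2^p"], intro conjI allI impI)
    fix R :: real
    assume R: "0 < R" "2 * K 0 \<le> R\<^sup>2"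
    define \<Lambda> where "\<Lambda> = R\<^sup>2 / K 0"
    have \<Lambda>: "2 \<le> \<Lambda>" "R\<^sup>2 / (2 * K 0) = \<Lambda> / 2" "- R\<^sup>2 / (20 * K 0) = - \<Lambda> / 20"
      using R variance_pos by (auto simp: \<Lambda>_def le_divide_eq)
    define N where "N = nat \<lceil>exp (\<Lambda> / 2)\<rceil>"
    have N: "exp (\<Lambda> / 2) \<le> N" "N \<le> 2 * exp (\<Lambda> / 2)" "1 \<le> exp (\<Lambda> / 2)"
    proof -
      show "exp (\<Lambda> / 2) \<le> N" by (simp add: N_def real_nat_ceiling_ge)
      show *: "1 \<le> exp (\<Lambda> / 2)" using \<Lambda> by simp
      have "real N \<le> exp (\<Lambda> / 2) + 1"
        unfolding N_def by (simp add: of_nat_nat)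
      then show "N \<le> 2 * exp (\<Lambda> / 2)" using * by linarith
    qed
    \<comment> \<open>\<open>A\<close>: the coarse grid is too high somewhere; \<open>D j\<close>: some increment of level \<open>p + j + 1\<close> is too large.\<close>
    define A where "A = (\<Union>k\<le>N * 2^p. {\<omega> \<in> space M. 21/20 * R \<le> X (real k / 2^p) \<omega>})"
    define u where "u = (\<lambda>j::nat. R / 80 * (3/4)^j)"
    define D where "D = (\<lambda>j. \<Union>k<N * 2^(p+j+1). {\<omega> \<in> space M. u j \<le> X (real k / 2^(p+j+1) + 1 / 2^(p+j+1)) \<omega> - X (real k / 2^(p+j+1)) \<omega>})"
    have [measurable]: "A \<in> events" "D j \<in> events" for j unfolding A_def D_def by measurable
    have A: "prob A \<le> 4 * 2^p * exp (- \<Lambda> / 20)"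
    proof -
      have "prob A \<le> (\<Sum>k\<le>N * 2^p. prob {\<omega> \<in> space M. 21/20 * R \<le> X (real k / 2^p) \<omega>})"
        unfolding A_def by (rule finite_measure_subadditive_finite) auto
      also have "\<dots> \<le> (\<Sum>k\<le>N * 2^p. exp (- ((21/20 * R)\<^sup>2) / (2 * K 0)))"
        by (intro sum_mono centred_normal_tail[OF X_normal]) (use R variance_pos in auto)
      also have "\<dots> = (N * 2^p + 1) * exp (- (441/800) * \<Lambda>)"
        by (simp add: \<Lambda>_def power_mult_distrib power_divide)
      also have "\<dots> \<le> (4 * 2^p * exp (\<Lambda> / 2)) * exp (- (441/800) * \<Lambda>)"
      proof (intro mult_right_mono)
        have "real N * 2^p + 1 \<le> (2 * exp (\<Lambda> / 2)) * 2^p + exp (\<Lambda> / 2) * 2^p"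
        proof (intro add_mono mult_right_mono N)
          have "1 * 1 \<le> exp (\<Lambda> / 2) * (2::real)^p" using N(3) by (intro mult_mono) auto
          then show "1 \<le> exp (\<Lambda> / 2) * (2::real)^p" by simp
        qed auto
        also have "\<dots> \<le> 4 * 2^p * exp (\<Lambda> / 2)" by simp
        finally show "real (N * 2^p + 1) \<le> 4 * 2^p * exp (\<Lambda> / 2)" by simp
      qed simp
      also have "\<dots> = 4 * 2^p * exp (\<Lambda> / 2 - (441/800) * \<Lambda>)" by (simp only: mult.assoc exp_add[symmetric]) simp
      also have "\<dots> \<le> 4 * 2^p * exp (- \<Lambda> / 20)" using \<Lambda>(1) by simp
      finally show ?thesis .
    qed
    have D: "prob (D j) \<le> 4 * 2^p * exp (- \<Lambda> / 2) * (1/2)^j" for j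
    proof -
      let ?q = "p + j + 1"
      have "prob (D j) \<le> (\<Sum>k<N * 2^?q. prob {\<omega> \<in> space M. u j \<le> X (real k / 2^?q + 1 / 2^?q) \<omega> - X (real k / 2^?q) \<omega>})"
        unfolding D_def by (rule finite_measure_subadditive_finite) auto
      also have "\<dots> \<le> (\<Sum>k<N * 2^?q. exp (- ((u j)\<^sup>2) / (2 * (L / 4^?q))))"
        by (intro sum_mono centred_normal_tail[OF increment_normal] L) (use R L in \<open>auto simp: u_def\<close>)
      also have "\<dots> = N * 2^?q * exp (- ((u j)\<^sup>2) / (2 * (L / 4^?q)))" by simp
      also have "\<dots> \<le> N * 2^?q * exp (- (real (1 + j) * \<Lambda>))"
      proof -
        have "(1 + j) * \<Lambda> \<le> (u j)\<^sup>2 / (2 * (L / 4^?q))"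
        proof -
          have pw: "((3/4)^j)\<^sup>2 * 4^j = (9/4 :: real)^j"
            by (simp add: power2_eq_square flip: power_mult_distrib)
          \<comment> \<open>\<open>9/4 = 4 (3/4)\<^sup>2\<close> is the growth rate of the exponents, and linear growth in \<open>j\<close> is all that is needed.\<close>
          have "1 + j * (5/4 :: real) \<le> (1 + 5/4)^j" by (rule Bernoulli_inequality) simp
          then have "1 + j \<le> (9/4 :: real)^j" by simp
          then have "(1 + j) * \<Lambda> \<le> (9/4)^j * \<Lambda>" using \<Lambda>(1) by (intro mult_right_mono) auto
          also have "\<dots> = (9/4)^j * R\<^sup>2 * (12800 * L) / (12800 * L * K 0)"
            using L(1) by (simp add: \<Lambda>_def)
          also have "\<dots> \<le> (9/4)^j * R\<^sup>2 * (4^p * K 0) / (12800 * L * K 0)"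
            using L(1) variance_pos by (intro divide_right_mono mult_left_mono p) auto
          also have "\<dots> = (9/4)^j * R\<^sup>2 * 4^p / (12800 * L)" using variance_pos by simp
          also have "\<dots> = ((3/4)^j)\<^sup>2 * 4^j * R\<^sup>2 * 4^p / (12800 * L)" by (simp only: pw)
          also have "\<dots> = (u j)\<^sup>2 * 4^(p+j) / (2 * L)"
            by (simp add: u_def power_mult_distrib power_divide power_add mult_ac)
          also have "\<dots> \<le> (u j)\<^sup>2 * 4^?q / (2 * L)"
            using L(1) by (intro divide_right_mono mult_left_mono) auto
          finally show ?thesis by (simp add: mult_ac)
        qed
        then show ?thesis by (intro mult_left_mono) auto
      qed
      also have "\<dots> \<le> (2 * exp (\<Lambda> / 2)) * 2^?q * exp (- (real (1 + j) * \<Lambda>))"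
        by (intro mult_right_mono) (use N(2) in auto)
      also have "\<dots> = 4 * 2^p * (exp (\<Lambda> / 2) * exp (- \<Lambda>)) * (2 * exp (- \<Lambda>))^j"
      proof -
        have e: "- (real (1 + j) * \<Lambda>) = - \<Lambda> + real j * (- \<Lambda>)" by (simp add: algebra_simps)
        show ?thesis unfolding e exp_add exp_of_nat_mult by (simp add: power_add power_mult_distrib)
      qed
      also have "exp (\<Lambda> / 2) * exp (- \<Lambda>) = exp (- \<Lambda> / 2)"
        by (simp flip: exp_add)
      also have "4 * 2^p * exp (- \<Lambda> / 2) * (2 * exp (- \<Lambda>))^j \<le> 4 * 2^p * exp (- \<Lambda> / 2) * (1/2)^j"
      proof (intro mult_left_mono power_mono)
        have "4 \<le> exp (2::real)"
        proof -
          have "(2::real)\<^sup>2 \<le> (exp 1)\<^sup>2" using exp_ge_add_one_self[of 1] by (intro power_mono) auto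
          then show ?thesis by (simp flip: exp_of_nat_mult)
        qed
        also have "\<dots> \<le> exp \<Lambda>" using \<Lambda> by simp
        finally show "2 * exp (- \<Lambda>) \<le> 1/2" by (simp add: exp_minus field_simps)
      qed auto
      finally show ?thesis .
    qed
    have sD: "summable (\<lambda>j. prob (D j))"
      by (rule summable_comparison_test'[of "\<lambda>j. 4 * 2^p * exp (- \<Lambda> / 2) * (1/2)^j" 0])
        (use D in \<open>auto intro!: summable_mult summable_geometric\<close>)
    have "prob (\<Union>j. D j) \<le> (\<Sum>j. prob (D j))"
      by (rule finite_measure_subadditive_countably[OF _ sD]) auto
    also have "\<dots> \<le> (\<Sum>j. 4 * 2^p * exp (- \<Lambda> / 2) * (1/2)^j)"
      by (intro suminf_le D sD summable_mult summable_geometric) auto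
    also have "\<dots> = 4 * 2^p * exp (- \<Lambda> / 2) * 2"
      by (subst suminf_mult) (auto simp: suminf_geometric intro!: summable_geometric)
    also have "\<dots> \<le> 4 * 2^p * exp (- \<Lambda> / 20) * 2" using \<Lambda>(1) by simp
    finally have UD: "prob (\<Union>j. D j) \<le> 8 * 2^p * exp (- \<Lambda> / 20)" by simp
    have "prob (A \<union> (\<Union>j. D j)) \<le> prob A + prob (\<Union>j. D j)" by (rule measure_Un_le) auto
    also have "\<dots> \<le> 12 * 2^p * exp (- \<Lambda> / 20)" using A UD by simp
    finally have prob: "prob (A \<union> (\<Union>j. D j)) \<le> 12 * 2^p * exp (- R\<^sup>2 / (20 * K 0))" by (simp only: \<Lambda>)
    have good: "\<forall>k\<le>N * 2^(p+j). X (real k / 2^(p+j)) \<omega> \<le> 11/10 * R - R/20 * (3/4)^j"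
      if \<omega>: "\<omega> \<in> space M - (A \<union> (\<Union>j. D j))" for \<omega> j
    proof (induction j)
      case 0
      show ?case
      proof (intro allI impI)
        fix k assume "k \<le> N * 2^(p+0)"
        then have "\<omega> \<notin> {\<omega> \<in> space M. 21/20 * R \<le> X (real k / 2^p) \<omega>}" using \<omega> unfolding A_def by auto
        then show "X (real k / 2^(p+0)) \<omega> \<le> 11/10 * R - R/20 * (3/4)^0" using \<omega> by simp
      qed
    next
      case (Suc j)
      show ?case
      proof (intro allI impI)
        fix k assume k: "k \<le> N * 2^(p+Suc j)"
        define i where "i = k div 2"
        have i: "i \<le> N * 2^(p+j)" using k unfolding i_def by simp
        have Xi: "X (real (2 * i) / 2^(p+j+1)) \<omega> \<le> 11/10 * R - R/20 * (3/4)^j"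
          using Suc.IH i by simp
        have u: "11/10 * R - R/20 * (3/4)^j + u j = 11/10 * R - R/20 * (3/4)^Suc j" by (simp add: u_def)
        have u0: "0 < u j" using R by (simp add: u_def)
        show "X (real k / 2^(p+Suc j)) \<omega> \<le> 11/10 * R - R/20 * (3/4)^Suc j"
        proof (cases "even k")
          case True
          then have "k = 2 * i" by (simp add: i_def)
          then show ?thesis using Xi u u0 by simp
        next
          case False
          then have k2: "k = 2 * i + 1" by (simp add: i_def)
          then have "2 * i < N * 2^(p+j+1)" using k by simp
          then have "\<omega> \<notin> {\<omega> \<in> space M. u j \<le> X (real (2 * i) / 2^(p+j+1) + 1 / 2^(p+j+1)) \<omega> - X (real (2 * i) / 2^(p+j+1)) \<omega>}"
            using \<omega> unfolding D_def by blast
          then have "X (real (2 * i) / 2^(p+j+1) + 1 / 2^(p+j+1)) \<omega> \<le> X (real (2 * i) / 2^(p+j+1)) \<omega> + u j"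
            using \<omega> by simp
          moreover have "real (2 * i) / 2^(p+j+1) + 1 / 2^(p+j+1) = real k / 2^(p+Suc j)"
            unfolding k2 by (simp add: add_divide_distrib)
          ultimately show ?thesis using Xi u by simp
        qed
      qed
    qed
    show "\<exists>B\<in>events. prob B \<le> 12 * 2^p * exp (- R\<^sup>2 / (20 * K 0)) \<and> dyadic_bound_off R B"
      unfolding dyadic_bound_off_def
    proof (intro bexI conjI exI ballI allI impI)
      show "A \<union> (\<Union>j. D j) \<in> events" by measurable
      show "prob (A \<union> (\<Union>j. D j)) \<le> 12 * 2^p * exp (- R\<^sup>2 / (20 * K 0))" by (rule prob)
      fix \<omega> j and k :: nat
      assume \<omega>: "\<omega> \<in> space M - (A \<union> (\<Union>j. D j))" and "k / 2^(p+j) \<le> exp (R\<^sup>2 / (2 * K 0))"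
      then have "k / 2^(p+j) \<le> real N" using N(1) \<Lambda>(2) by simp
      then have "real k \<le> real (N * 2^(p+j))" by (simp add: divide_le_eq)
      then have "k \<le> N * 2^(p+j)" by (simp only: of_nat_le_iff)
      then have "X (real k / 2^(p+j)) \<omega> \<le> 11/10 * R - R/20 * (3/4)^j" using good[OF \<omega>] by blast
      also have "\<dots> \<le> 11/10 * R" using R by simp
      finally show "X (real k / 2^(p+j)) \<omega> \<le> 11/10 * R" .
    qed
  qed simp
qed

text \<open>
  The Borel--Cantelli lemma along integer heights; continuity extends the bound from dyadic times to all
  times.
\<close>

lemma eventually_upper_bound:
  "AE \<omega> in M. \<forall>\<^sub>F n in sequentially. \<forall>t. 0 \<le> t \<and> t \<le> exp ((real n)\<^sup>2 / (2 * K 0)) \<longrightarrow> X t \<omega> \<le> 11/10 * real n"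
proof -
  from dyadic_bound_off_small_event obtain C where C: "0 < C"
    "\<forall>R>0. 2 * K 0 \<le> R\<^sup>2 \<longrightarrow>
       (\<exists>B\<in>events. prob B \<le> C * exp (- R\<^sup>2 / (20 * K 0)) \<and> dyadic_bound_off R B)"
    by (elim exE conjE)
  obtain n0 :: nat where n0: "2 * K 0 + 1 \<le> n0" using real_arch_simple by blast
  have large: "0 < real n" "2 * K 0 \<le> (real n)\<^sup>2" if "n0 \<le> n" for n
  proof -
    have n: "2 * K 0 + 1 \<le> real n" using n0 that by linarith
    then show "0 < real n" using variance_pos by linarith
    have "real n * 1 \<le> real n * real n" using n variance_pos by (intro mult_left_mono) auto
    then show "2 * K 0 \<le> (real n)\<^sup>2" using n by (simp add: power2_eq_square)
  qed
  have "\<exists>B. B \<in> events \<and> (n0 \<le> n \<longrightarrow> prob B \<le> C * exp (- (real n)\<^sup>2 / (20 * K 0)) \<and> dyadic_bound_off n B)" for n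
  proof (cases "n0 \<le> n")
    case True
    then show ?thesis using C(2) large[OF True] by blast
  qed (use sets.empty_sets in blast)
  then obtain B where B: "\<And>n. B n \<in> events"
    "\<And>n. n0 \<le> n \<Longrightarrow> prob (B n) \<le> C * exp (- (real n)\<^sup>2 / (20 * K 0))" "\<And>n. n0 \<le> n \<Longrightarrow> dyadic_bound_off n (B n)"
    by metis
  have "summable (\<lambda>n. prob (B n))"
  proof (rule summable_comparison_test')
    show "summable (\<lambda>n. C * exp (- (real n)\<^sup>2 / (20 * K 0)))"
      by (intro summable_mult summable_exp_neg_square) (use variance_pos in simp)
    show "norm (prob (B n)) \<le> C * exp (- (real n)\<^sup>2 / (20 * K 0))" if "n0 \<le> n" for n
      using B(2)[OF that] by simp
  qed
  then have "AE \<omega> in M. \<forall>\<^sub>F n in sequentially. \<omega> \<in> space M - B n"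
    by (intro borel_cantelli_AE1) (auto simp: B emeasure_eq_measure)
  then show ?thesis
    using smooth
  proof eventually_elim
    case (elim \<omega>)
    have "\<forall>\<^sub>F n in sequentially. \<omega> \<in> space M - B n \<and> n0 \<le> n"
      using elim(1) eventually_ge_at_top[of n0] by eventually_elim auto
    then show ?case
    proof (eventually_elim, intro allI impI)
      fix n t assume n: "\<omega> \<in> space M - B n \<and> n0 \<le> n" and t: "0 \<le> t \<and> t \<le> exp ((real n)\<^sup>2 / (2 * K 0))"
      obtain p where p: "\<And>j k. real k / 2^(p+j) \<le> exp ((real n)\<^sup>2 / (2 * K 0)) \<Longrightarrow> X (real k / 2^(p+j)) \<omega> \<le> 11/10 * real n"
        using B(3)[of n] n unfolding dyadic_bound_off_def by blast
      define s where "s = (\<lambda>j. real (nat \<lfloor>t * 2^(p+j)\<rfloor>) / 2^(p+j))"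
      have s: "t - 1 / 2^(p+j) \<le> s j" "s j \<le> t" for j
      proof -
        have e: "real (nat \<lfloor>t * 2^(p+j)\<rfloor>) = of_int \<lfloor>t * 2^(p+j)\<rfloor>" using t by simp
        have "of_int \<lfloor>t * 2^(p+j)\<rfloor> \<le> t * 2^(p+j)" "t * 2^(p+j) - 1 \<le> of_int \<lfloor>t * 2^(p+j)\<rfloor>" by linarith+
        then show "t - 1 / 2^(p+j) \<le> s j" "s j \<le> t"
          unfolding s_def e by (simp_all add: pos_le_divide_eq pos_divide_le_eq left_diff_distrib)
      qed
      have "(\<lambda>j. 1 / 2^(p+j) :: real) \<longlonglongrightarrow> 0"
        using LIMSEQ_ignore_initial_segment[OF LIMSEQ_divide_realpow_zero[of 2 1], of p] by (simp add: add.commute)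
      then have "(\<lambda>j. t - 1 / 2^(p+j)) \<longlonglongrightarrow> t - 0" by (intro tendsto_intros)
      then have st: "s \<longlonglongrightarrow> t"
        by (intro tendsto_sandwich[of "\<lambda>j. t - 1 / 2^(p+j)" s sequentially "\<lambda>_. t" t]) (use s in auto)
      have "isCont (\<lambda>t. X t \<omega>) t"
        using elim(2) unfolding C2_smooth_def by (blast intro: DERIV_isCont)
      then have "(\<lambda>j. X (s j) \<omega>) \<longlonglongrightarrow> X t \<omega>" using st by (rule isCont_tendsto_compose)
      moreover have "X (s j) \<omega> \<le> 11/10 * real n" for j
        unfolding s_def by (rule p) (use s(2)[of j] t in \<open>simp add: s_def\<close>)
      ultimately show "X t \<omega> \<le> 11/10 * real n" by (intro LIMSEQ_le_const2) auto
    qed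
  qed
qed

end

section \<open>Stationary Gaussian processes: deep valleys\<close>

context stationary_gaussian
begin

lemma exp_moment: "integrable M (\<lambda>\<omega>. exp (c * X t \<omega>))" "expectation (\<lambda>\<omega>. exp (c * X t \<omega>)) = exp (c\<^sup>2 * K 0 / 2)"
  using centred_normal_exp_scale[OF X_normal] by auto

lemma exp_moment_pair:
  "integrable M (\<lambda>\<omega>. exp (c * X s \<omega>) * exp (c * X t \<omega>))"
  "expectation (\<lambda>\<omega>. exp (c * X s \<omega>) * exp (c * X t \<omega>)) = exp (c\<^sup>2 * K 0) * exp (c\<^sup>2 * K (t - s))"
proof -
  note * = centred_normal_exp_scale[OF two_point_normal[of 1 1 t s], of c]
  have "exp (c * X s \<omega>) * exp (c * X t \<omega>) = exp (c * (1 * X s \<omega> + 1 * X t \<omega>))" for \<omega>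
    by (simp add: distrib_left exp_add)
  moreover have "c\<^sup>2 * (1\<^sup>2 * K 0 + 1\<^sup>2 * K 0 + 2 * 1 * 1 * K (t - s)) / 2 = c\<^sup>2 * K 0 + c\<^sup>2 * K (t - s)"
    by (simp add: algebra_simps)
  ultimately show "integrable M (\<lambda>\<omega>. exp (c * X s \<omega>) * exp (c * X t \<omega>))"
    "expectation (\<lambda>\<omega>. exp (c * X s \<omega>) * exp (c * X t \<omega>)) = exp (c\<^sup>2 * K 0) * exp (c\<^sup>2 * K (t - s))"
    using * by (simp_all add: add_divide_distrib flip: exp_add)
qed

text \<open>
  Second moment method for the normalised sum \<open>Z\<close> of the \<open>exp(c X(t))\<close>: the first two conditions give
  \<open>E Z\<^sup>2 \<le> 2\<close>. When no point reaches the level \<open>a\<close>, tilting back by \<open>d\<close> bounds \<open>Z\<close> by \<open>W\<close>, whose expectation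
  is at most 1/4 by the last condition; otherwise \<open>Z \<le> Z\<^sup>2/4 + 1\<close>. Taking expectations,
  \<open>1 \<le> 1/4 + 2/4 + P\<close> with \<open>P\<close> the probability in question.
\<close>

lemma prob_exceedance_ge:
  assumes T: "finite T" "T \<noteq> {}"
    and diag: "exp (c\<^sup>2 * K 0) \<le> card T / 2"
    and off: "\<And>s t. s \<in> T \<Longrightarrow> t \<in> T \<Longrightarrow> s \<noteq> t \<Longrightarrow> exp (c\<^sup>2 * K (t - s)) \<le> 3/2"
    and low: "0 \<le> d" "exp ((c - d)\<^sup>2 * K 0 / 2 + d * a) \<le> exp (c\<^sup>2 * K 0 / 2) / 4"
  shows "1/4 \<le> prob {\<omega> \<in> space M. \<exists>t\<in>T. a \<le> X t \<omega>}"
proof -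
  define m where "m = card T * exp (c\<^sup>2 * K 0 / 2)"
  have N: "0 < real (card T)" using T by (simp add: card_gt_0_iff)
  have m: "0 < m" using N by (simp add: m_def)
  define Z where "Z = (\<lambda>\<omega>. (\<Sum>t\<in>T. exp (c * X t \<omega>)) / m)"
  define W where "W = (\<lambda>\<omega>. (\<Sum>t\<in>T. exp ((c - d) * X t \<omega>) * exp (d * a)) / m)"
  let ?G = "{\<omega> \<in> space M. \<exists>t\<in>T. a \<le> X t \<omega>}"
  have [measurable]: "?G \<in> events" using T by measurable
  have iZ: "integrable M Z" unfolding Z_def using exp_moment by simp
  have EZ: "expectation Z = 1"
    unfolding Z_def using exp_moment N by (simp add: m_def)
  have iW: "integrable M W" unfolding W_def using exp_moment by simp
  have "expectation W = card T * (exp ((c - d)\<^sup>2 * K 0 / 2) * exp (d * a)) / m"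
    unfolding W_def using exp_moment by simp
  also have "\<dots> \<le> card T * (exp (c\<^sup>2 * K 0 / 2) / 4) / m"
    using low(2) m by (intro divide_right_mono mult_left_mono) (auto simp: exp_add)
  also have "\<dots> = 1/4" using N by (simp add: m_def)
  finally have EW: "expectation W \<le> 1/4" .
  have Z2: "(Z \<omega>)\<^sup>2 = (\<Sum>s\<in>T. \<Sum>t\<in>T. exp (c * X s \<omega>) * exp (c * X t \<omega>)) / m\<^sup>2" for \<omega>
    unfolding Z_def by (simp add: power_divide power2_eq_square sum_product)
  have iZ2: "integrable M (\<lambda>\<omega>. (Z \<omega>)\<^sup>2)" unfolding Z2 using exp_moment_pair by simp
  have "expectation (\<lambda>\<omega>. (Z \<omega>)\<^sup>2) = (\<Sum>s\<in>T. \<Sum>t\<in>T. exp (c\<^sup>2 * K 0) * exp (c\<^sup>2 * K (t - s))) / m\<^sup>2"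
    unfolding Z2 using exp_moment_pair by simp
  also have "\<dots> \<le> (\<Sum>s\<in>T. \<Sum>t\<in>T. exp (c\<^sup>2 * K 0) * (3/2 + (if t = s then card T / 2 else 0))) / m\<^sup>2"
  proof (intro divide_right_mono sum_mono mult_left_mono)
    fix s t assume "s \<in> T" "t \<in> T"
    then show "exp (c\<^sup>2 * K (t - s)) \<le> 3/2 + (if t = s then card T / 2 else 0)"
      using diag off[of s t] by (cases "s = t") auto
  qed auto
  also have "\<dots> = 2"
  proof -
    have "(\<Sum>s\<in>T. \<Sum>t\<in>T. exp (c\<^sup>2 * K 0) * (3/2 + (if t = s then card T / 2 else 0))) =
        exp (c\<^sup>2 * K 0) * (\<Sum>s\<in>T. card T * (3/2) + card T / 2)"
      using T by (simp add: sum_distrib_left[symmetric] sum.distrib)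
    also have "\<dots> = 2 * m\<^sup>2"
    proof -
      have "(exp (c\<^sup>2 * K 0 / 2))\<^sup>2 = exp (c\<^sup>2 * K 0)" by (simp flip: exp_of_nat_mult)
      then show ?thesis by (simp add: m_def power_mult_distrib power2_eq_square[of "real (card T)"])
    qed
    finally show ?thesis using m by simp
  qed
  finally have EZ2: "expectation (\<lambda>\<omega>. (Z \<omega>)\<^sup>2) \<le> 2" .
  have "expectation Z \<le> expectation (\<lambda>\<omega>. W \<omega> + (Z \<omega>)\<^sup>2 / 4 + indicat_real ?G \<omega>)"
  proof (rule integral_mono[OF iZ])
    have "integrable M (indicat_real ?G)" by (rule integrable_const_bound[of _ 1]) auto
    then show "integrable M (\<lambda>\<omega>. W \<omega> + (Z \<omega>)\<^sup>2 / 4 + indicat_real ?G \<omega>)"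
      using iW iZ2 by (intro Bochner_Integration.integrable_add integrable_divide)
    fix \<omega> assume \<omega>: "\<omega> \<in> space M"
    have W0: "0 \<le> W \<omega>" unfolding W_def using m by (intro divide_nonneg_pos sum_nonneg) auto
    show "Z \<omega> \<le> W \<omega> + (Z \<omega>)\<^sup>2 / 4 + indicat_real ?G \<omega>"
    proof (cases "\<omega> \<in> ?G")
      case True
      have "0 \<le> (Z \<omega> / 2 - 1)\<^sup>2" by simp
      also have "\<dots> = (Z \<omega>)\<^sup>2 / 4 + 1 - Z \<omega>" by (simp add: power2_eq_square field_simps)
      finally show ?thesis using True W0 by simp
    next
      case False
      have "Z \<omega> \<le> W \<omega>"
        unfolding Z_def W_def
      proof (intro divide_right_mono sum_mono)
        fix t assume "t \<in> T"
        then have "d * X t \<omega> \<le> d * a" using False \<omega> low(1) by (intro mult_left_mono) (auto intro: less_imp_le)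
        then show "exp (c * X t \<omega>) \<le> exp ((c - d) * X t \<omega>) * exp (d * a)"
          by (simp add: left_diff_distrib flip: exp_add)
      qed (use m in simp)
      then show ?thesis using False by (simp add: add_increasing2)
    qed
  qed
  also have "\<dots> = expectation W + expectation (\<lambda>\<omega>. (Z \<omega>)\<^sup>2) / 4 + prob ?G"
  proof -
    have "integrable M (indicat_real ?G)" by (rule integrable_const_bound[of _ 1]) auto
    then show ?thesis using iW iZ2 by (subst Bochner_Integration.integral_add; simp)+
  qed
  finally show ?thesis using EZ EW EZ2 by simp
qed

text \<open>
  With \<open>L = R\<^sup>2 / K(0)\<close>, take about \<open>N = exp(15/32 L)\<close> times with spacing \<open>S = exp(L/32)\<close>; they fit into the
  interval of length \<open>exp(L/2)\<close>. At distance at least \<open>S\<close> the covariance is \<open>o(1/L)\<close>, hence negligible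
  against the exponent \<open>c\<^sup>2\<close> of order \<open>L\<close>. The tilt \<open>c = 2R / (3 K(0))\<close> produces values near \<open>2/3 R\<close> and has
  \<open>c\<^sup>2 K(0) = 4/9 L\<close>; this is below \<open>ln N\<close>, which is what the diagonal of the second moment requires.
  Since 2/3 exceeds 3/5, the values below \<open>3/5 R\<close> contribute little.
\<close>

lemma prob_high_point_ge:
  "\<forall>\<^sub>F R in at_top. \<exists>T. finite T \<and> T \<noteq> {} \<and> T \<subseteq> {0..exp (R\<^sup>2 / (2 * K 0))} \<and>
     1/4 \<le> prob {\<omega> \<in> space M. \<exists>t\<in>T. 3/5 * R \<le> X t \<omega>}"
proof -
  define \<Lambda> where "\<Lambda> = (\<lambda>R. R\<^sup>2 / K 0)"
  have \<Lambda>_top: "filterlim \<Lambda> at_top at_top"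
    unfolding \<Lambda>_def using variance_pos by real_asymp
  have 1: "\<forall>\<^sub>F x in at_top. 2 * exp (4/9 * x) \<le> exp (15/32 * x) - (1::real)" by real_asymp
  have 2: "\<forall>\<^sub>F x in at_top. 11/50 * x \<le> 2/9 * x - ln (4::real)" by real_asymp
  have "\<forall>\<^sub>F t in at_top. K t * ln t < K 0 / 64"
    using variance_pos by (intro order_tendstoD[OF decay]) auto
  then obtain t0 where t0: "\<And>t. t0 \<le> t \<Longrightarrow> K t * ln t < K 0 / 64"
    by (auto simp: eventually_at_top_linorder)
  have 3: "\<forall>\<^sub>F x in at_top. t0 \<le> exp (x / 32)" by real_asymp
  have "\<forall>\<^sub>F x in at_top. 2 * exp (4/9 * x) \<le> exp (15/32 * x) - (1::real) \<and> 11/50 * x \<le> 2/9 * x - ln 4 \<and> t0 \<le> exp (x / 32) \<and> 0 < x"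
    by (intro eventually_conj 1 2 3 eventually_gt_at_top)
  from eventually_compose_filterlim[OF this \<Lambda>_top] show ?thesis
    using eventually_gt_at_top[of 0]
  proof eventually_elim
    case (elim R)
    define L where "L = \<Lambda> R"
    have L: "2 * exp (4/9 * L) \<le> exp (15/32 * L) - 1" "11/50 * L \<le> 2/9 * L - ln 4" "t0 \<le> exp (L / 32)" "0 < L" "0 < R"
      using elim unfolding L_def by auto
    have RL: "R\<^sup>2 = L * K 0" using variance_pos by (simp add: L_def \<Lambda>_def)
    define S where "S = exp (L / 32)"
    define N where "N = nat \<lfloor>exp (15/32 * L)\<rfloor>"
    have N: "real N \<le> exp (15/32 * L)" "exp (15/32 * L) - 1 \<le> real N"
      unfolding N_def by (simp_all add: of_nat_nat)
    have S: "1 < S" using L by (simp add: S_def)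
    define T where "T = (\<lambda>k. real k * S) ` {..<N}"
    have inj: "inj_on (\<lambda>k. real k * S) {..<N}" using S by (auto simp: inj_on_def)
    have card: "card T = N" by (simp add: T_def card_image[OF inj])
    have "0 < real N" using N(2) L(1) exp_gt_zero[of "4/9 * L"] by linarith
    then have "0 < N" by simp
    define c where "c = 2/3 * R / K 0"
    have c2: "c\<^sup>2 * K 0 = 4/9 * L"
      using variance_pos by (simp add: c_def power_divide power_mult_distrib RL) (simp add: power2_eq_square)
    have far: "exp (c\<^sup>2 * K u) \<le> 3/2" if u: "S \<le> u" for u
    proof -
      have "0 < u" using u S by linarith
      then have lnu: "L / 32 \<le> ln u" using u by (subst ln_ge_iff) (auto simp: S_def)
      have Ku: "K u * ln u < K 0 / 64" using t0 u L unfolding S_def by auto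
      have "K u \<le> K 0 / (2 * L)"
      proof (cases "K u \<le> 0")
        case True
        have "0 \<le> K 0 / (2 * L)" using variance_pos L by simp
        then show ?thesis using True by linarith
      next
        case False
        then have "K u * (L / 32) \<le> K u * ln u" using lnu by (intro mult_left_mono) auto
        then have "K u * (L / 32) \<le> K 0 / 64" using Ku by linarith
        then show ?thesis using L by (simp add: field_simps)
      qed
      then have "c\<^sup>2 * K u \<le> c\<^sup>2 * (K 0 / (2 * L))" by (intro mult_left_mono) auto
      also have "\<dots> = (c\<^sup>2 * K 0) / (2 * L)" by simp
      also have "\<dots> = 2/9" unfolding c2 using L by simp
      finally have "exp (c\<^sup>2 * K u) \<le> exp (2/9)" by simp
      also have "\<dots> \<le> 1 + 2/9 + (2/9)\<^sup>2" by (rule exp_bound) auto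
      also have "\<dots> \<le> 3/2" by (simp add: power2_eq_square)
      finally show ?thesis .
    qed
    have off: "exp (c\<^sup>2 * K (t - s)) \<le> 3/2" if st: "s \<in> T" "t \<in> T" "s \<noteq> t" for s t
    proof -
      obtain i j where ij: "s = real i * S" "t = real j * S" "i \<noteq> j" using st by (auto simp: T_def)
      have "1 * S \<le> \<bar>real j - real i\<bar> * S" using ij S by (intro mult_right_mono) auto
      also have "\<dots> = \<bar>t - s\<bar>" using S by (simp add: ij abs_mult flip: left_diff_distrib)
      finally have "exp (c\<^sup>2 * K \<bar>t - s\<bar>) \<le> 3/2" by (intro far) simp
      moreover have "K \<bar>t - s\<bar> = K (t - s)" using K_minus[of "t - s"] by (simp add: abs_if)
      ultimately show ?thesis by simp
    qed
    have "1/4 \<le> prob {\<omega> \<in> space M. \<exists>t\<in>T. 3/5 * R \<le> X t \<omega>}"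
    proof (rule prob_exceedance_ge[where c = c and d = "c / 10"])
      show "finite T" "T \<noteq> {}" using \<open>0 < N\<close> by (auto simp: T_def)
      show "exp (c\<^sup>2 * K 0) \<le> card T / 2" unfolding c2 card using L(1) N(2) by linarith
      show "0 \<le> c / 10" using L variance_pos by (simp add: c_def)
      have "c * (3/5 * R) = 2/5 * L"
        using variance_pos by (simp add: c_def field_simps power2_eq_square[symmetric] RL)
      moreover have "(c - c / 10)\<^sup>2 * K 0 = 81/100 * (c\<^sup>2 * K 0)" by (simp add: power2_eq_square)
      ultimately have "(c - c / 10)\<^sup>2 * K 0 / 2 + c / 10 * (3/5 * R) = 11/50 * L"
        unfolding c2 by (simp add: mult_ac)
      also have "\<dots> \<le> c\<^sup>2 * K 0 / 2 - ln 4" using L(2) unfolding c2 by simp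
      finally have "exp ((c - c / 10)\<^sup>2 * K 0 / 2 + c / 10 * (3/5 * R)) \<le> exp (c\<^sup>2 * K 0 / 2 - ln 4)"
        by (simp only: exp_le_cancel_iff)
      then show "exp ((c - c / 10)\<^sup>2 * K 0 / 2 + c / 10 * (3/5 * R)) \<le> exp (c\<^sup>2 * K 0 / 2) / 4"
        by (simp only: exp_diff exp_ln zero_less_numeral)
    qed (rule off)
    moreover have "T \<subseteq> {0..exp (R\<^sup>2 / (2 * K 0))}"
    proof
      fix t assume "t \<in> T"
      then obtain k where k: "t = real k * S" "k < N" by (auto simp: T_def)
      have "t \<le> real N * S" using k S by simp
      also have "\<dots> \<le> exp (15/32 * L) * S" using N(1) S by (intro mult_right_mono) auto
      also have "\<dots> = exp (R\<^sup>2 / (2 * K 0))"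
        using variance_pos by (simp add: S_def RL flip: exp_add)
      finally show "t \<in> {0..exp (R\<^sup>2 / (2 * K 0))}" using k S by simp
    qed
    moreover have "finite T" "T \<noteq> {}" using \<open>0 < N\<close> by (auto simp: T_def)
    ultimately show ?case by blast
  qed
qed

text \<open>
  The level \<open>3/5 n\<close> is reached with probability at least 1/4, so by concentration the lower level
  \<open>29/50 n\<close> is missed with probability \<open>O(1/n\<^sup>2)\<close>, which is summable.
\<close>

lemma eventually_high_point:
  "AE \<omega> in M. \<forall>\<^sub>F n in sequentially. \<exists>t. 0 \<le> t \<and> t \<le> exp ((real n)\<^sup>2 / (2 * K 0)) \<and> 29/50 * real n \<le> X t \<omega>"
proof -
  define P where "P = (\<lambda>n T. finite T \<and> T \<noteq> {} \<and> T \<subseteq> {0..exp ((real n)\<^sup>2 / (2 * K 0))} \<and>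
     1/4 \<le> prob {\<omega> \<in> space M. \<exists>t\<in>T. 3/5 * real n \<le> X t \<omega>})"
  have "\<forall>\<^sub>F n in sequentially. \<exists>T. P n T"
    unfolding P_def by (rule eventually_compose_filterlim[OF prob_high_point_ge filterlim_real_sequentially])
  then obtain n0 where n0: "\<And>n. n0 \<le> n \<Longrightarrow> \<exists>T. P n T" by (auto simp: eventually_sequentially)
  define T where "T = (\<lambda>n. SOME T. P n T)"
  have T: "P n (T n)" if "n0 \<le> n" for n unfolding T_def by (rule someI_ex) (rule n0[OF that])
  define B where "B = (\<lambda>n. {\<omega> \<in> space M. n0 \<le> n \<and> (\<forall>t\<in>T n. X t \<omega> < 29/50 * real n)})"
  have [measurable]: "B n \<in> events" for n
  proof (cases "n0 \<le> n")
    case True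
    then have "finite (T n)" using T by (simp add: P_def)
    then show ?thesis unfolding B_def by measurable
  qed (simp add: B_def)
  have bound: "prob (B n) \<le> 40000 * pi\<^sup>2 * K 0 * inverse (real n ^ 2)" if n: "n0 \<le> n" "1 \<le> n" for n
  proof -
    let ?b = "prob {\<omega> \<in> space M. \<exists>t\<in>T n. 3/5 * real n \<le> X t \<omega>}"
    have "prob (B n) * (1/4) \<le> prob (B n) * ?b"
      using T[OF n(1)] by (intro mult_left_mono) (auto simp: P_def)
    also have "\<dots> = prob {\<omega> \<in> space M. \<forall>t\<in>T n. X t \<omega> < 29/50 * real n} * ?b"
      using n by (simp add: B_def)
    also have "\<dots> \<le> 4 * pi\<^sup>2 * K 0 / (3/5 * real n - 29/50 * real n)\<^sup>2"
      using T[OF n(1)] n by (intro prob_Max_levels) (auto simp: P_def variance)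
    also have "\<dots> = 10000 * pi\<^sup>2 * K 0 * inverse (real n ^ 2)"
      by (simp add: power_divide power_mult_distrib inverse_eq_divide)
    finally show ?thesis by simp
  qed
  have "summable (\<lambda>n. prob (B n))"
  proof (rule summable_comparison_test'[where N = "max n0 1"])
    show "summable (\<lambda>n. 40000 * pi\<^sup>2 * K 0 * inverse (real n ^ 2))"
      by (rule summable_mult) (rule inverse_power_summable, simp)
    show "norm (prob (B n)) \<le> 40000 * pi\<^sup>2 * K 0 * inverse (real n ^ 2)" if "max n0 1 \<le> n" for n
      using bound[of n] that by simp
  qed
  then have "AE \<omega> in M. \<forall>\<^sub>F n in sequentially. \<omega> \<in> space M - B n"
    by (intro borel_cantelli_AE1) (auto simp: emeasure_eq_measure)
  then show ?thesis
  proof eventually_elim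
    case (elim \<omega>)
    then show ?case
      using eventually_ge_at_top[of n0]
    proof eventually_elim
      case (elim n)
      then obtain t where t: "t \<in> T n" "\<not> X t \<omega> < 29/50 * real n" by (auto simp: B_def)
      have "T n \<subseteq> {0..exp ((real n)\<^sup>2 / (2 * K 0))}" using T elim by (simp add: P_def)
      then show ?case using t by (intro exI[of _ t]) auto
    qed
  qed
qed

lemma stationary_gaussian_uminus: "stationary_gaussian M (\<lambda>t \<omega>. - X t \<omega>) K"
proof
  show "\<exists>v. centred_normal M v (\<lambda>\<omega>. \<Sum>t\<in>T. a t * - X t \<omega>)" if "finite T" for T a
    using normal_combination[OF that, of "\<lambda>t. - a t"] by simp
  show "expectation (\<lambda>\<omega>. - X s \<omega> * - X t \<omega>) = K (t - s)" for s t
    using covariance by simp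
  show "AE \<omega> in M. C2_smooth (\<lambda>t. - X t \<omega>)"
    using smooth
  proof eventually_elim
    case (elim \<omega>)
    then obtain h' h'' where h: "\<And>t. ((\<lambda>t. X t \<omega>) has_real_derivative h' t) (at t)"
      "\<And>t. (h' has_real_derivative h'' t) (at t)" "continuous_on UNIV h''"
      unfolding C2_smooth_def by blast
    show ?case
      unfolding C2_smooth_def
      by (intro exI[of _ "\<lambda>t. - h' t"] exI[of _ "\<lambda>t. - h'' t"] conjI allI DERIV_minus h continuous_on_minus)
  qed
qed (fact variance_pos decay)+

lemma eventually_low_point:
  "AE \<omega> in M. \<forall>\<^sub>F n in sequentially. \<exists>t. 0 \<le> t \<and> t \<le> exp ((real n)\<^sup>2 / (2 * K 0)) \<and> X t \<omega> \<le> - (29/50 * real n)"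
proof -
  interpret minus: stationary_gaussian M "\<lambda>t \<omega>. - X t \<omega>" K by (rule stationary_gaussian_uminus)
  show ?thesis using minus.eventually_high_point by (simp only: le_minus_iff)
qed

end

section \<open>A staircase of deep valleys\<close>

lemma coordinate_line_connected:
  fixes G :: "'d::finite \<Rightarrow> real \<Rightarrow> real" and p :: "real ^ 'd"
  assumes bound: "\<And>t. 0 \<le> t \<Longrightarrow> t \<le> T \<Longrightarrow> G i t + (\<Sum>k\<in>UNIV - {i}. G k (p $ k)) \<le> l"
    and p: "0 \<le> p $ i" "p $ i \<le> T" and q: "0 \<le> s" "s \<le> T"
  shows "connected_component {x. (\<Sum>k\<in>UNIV. G k (x $ k)) \<le> l} p (\<chi> k. if k = i then s else p $ k)"
proof -
  define line where "line = (\<lambda>t. (\<chi> k. if k = i then t else p $ k) :: real ^ 'd)"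
  have line_nth: "line t $ k = (if k = i then t else p $ k)" for t k by (simp add: line_def)
  have cont: "continuous_on UNIV line" unfolding line_def
  proof (rule continuous_on_vec_lambda)
    show "continuous_on UNIV (\<lambda>t. if k = i then t else p $ k)" for k by (cases "k = i") auto
  qed
  have "connected (line ` {0..T})"
    by (intro connected_continuous_image continuous_on_subset[OF cont]) auto
  moreover have "line ` {0..T} \<subseteq> {x. (\<Sum>k\<in>UNIV. G k (x $ k)) \<le> l}"
  proof clarify
    fix t assume t: "t \<in> {0..T}"
    have "(\<Sum>k\<in>UNIV. G k (line t $ k)) = G i (line t $ i) + (\<Sum>k\<in>UNIV - {i}. G k (line t $ k))"
      by (rule sum.remove) auto
    also have "\<dots> = G i t + (\<Sum>k\<in>UNIV - {i}. G k (p $ k))"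
      by (simp add: line_nth)
    finally show "(\<Sum>k\<in>UNIV. G k (line t $ k)) \<le> l" using bound[of t] t by simp
  qed
  moreover have "p = line (p $ i)" by (simp add: vec_eq_iff line_nth)
  ultimately have "connected_component {x. (\<Sum>k\<in>UNIV. G k (x $ k)) \<le> l} (line (p $ i)) (line s)"
    using p q by (intro connected_componentI[of "line ` {0..T}"]) auto
  then show ?thesis by (simp only: \<open>p = line (p $ i)\<close>[symmetric]) (simp add: line_def)
qed

text \<open>
  Let \<open>v n i\<close> be the place of the valley of coordinate \<open>i\<close> at scale \<open>n\<close>. The corners of the staircase are
  the points \<open>p n\<close> with coordinates \<open>v n a, v n b, v n c\<close> (and 0 elsewhere), and \<open>p n\<close> is joined to
  \<open>p (n + 1)\<close> by moving one of the three coordinates at a time. During each move the other two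
  contribute at most \<open>-2 \<cdot> 29/50 n\<close> and the moving one at most \<open>11/10 (n + 1)\<close>, so the sum is at most
  \<open>11/10 - 6/100 n + D\<close>, where \<open>D\<close> is the constant contribution of the remaining coordinates.
\<close>

lemma unbounded_component_of_deep_valleys:
  fixes G :: "'d::finite \<Rightarrow> real \<Rightarrow> real" and T :: "'d \<Rightarrow> nat \<Rightarrow> real"
  assumes abc: "a \<noteq> b" "a \<noteq> c" "b \<noteq> c"
    and T: "\<And>i n. T i n \<le> T i (Suc n)"
    and cont: "continuous_on UNIV (G a)"
    and upper: "\<And>i. i \<in> {a, b, c} \<Longrightarrow> \<forall>\<^sub>F n in sequentially. \<forall>t. 0 \<le> t \<and> t \<le> T i n \<longrightarrow> G i t \<le> 11/10 * real n"
    and lower: "\<And>i. i \<in> {a, b, c} \<Longrightarrow> \<forall>\<^sub>F n in sequentially. \<exists>t. 0 \<le> t \<and> t \<le> T i n \<and> G i t \<le> - (29/50 * real n)"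
  shows "\<exists>C\<in>components {x. (\<Sum>k\<in>UNIV. G k (x $ k)) \<le> l}. \<not> bounded C"
proof -
  define S where "S = {x :: real ^ 'd. (\<Sum>k\<in>UNIV. G k (x $ k)) \<le> l}"
  define D where "D = (\<Sum>k\<in>UNIV - {a, b, c}. G k 0)"
  define Q where "Q = (\<lambda>n i. (\<forall>t. 0 \<le> t \<and> t \<le> T i n \<longrightarrow> G i t \<le> 11/10 * real n) \<and>
      (\<exists>t. 0 \<le> t \<and> t \<le> T i n \<and> G i t \<le> - (29/50 * real n)))"
  have "\<forall>\<^sub>F n in sequentially. Q n i" if "i \<in> {a, b, c}" for i
    unfolding Q_def by (intro eventually_conj upper lower that)
  then have "\<forall>\<^sub>F n in sequentially. \<forall>i\<in>{a, b, c}. Q n i"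
    by (intro eventually_ball_finite) auto
  moreover have "\<forall>\<^sub>F n in sequentially. 11/10 - 6/100 * real n + D \<le> l" by real_asymp
  ultimately have "\<forall>\<^sub>F n in sequentially. (\<forall>i\<in>{a, b, c}. Q n i) \<and> 11/10 - 6/100 * real n + D \<le> l"
    by (rule eventually_conj)
  then obtain N where N: "\<forall>n\<ge>N. (\<forall>i\<in>{a, b, c}. Q n i) \<and> 11/10 - 6/100 * real n + D \<le> l"
    unfolding eventually_sequentially by blast
  define v where "v = (\<lambda>n i. SOME t. 0 \<le> t \<and> t \<le> T i n \<and> G i t \<le> - (29/50 * real n))"
  have v: "0 \<le> v n i \<and> v n i \<le> T i n \<and> G i (v n i) \<le> - (29/50 * real n)" if "N \<le> n" "i \<in> {a, b, c}" for n i
  proof -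
    have "\<exists>t. 0 \<le> t \<and> t \<le> T i n \<and> G i t \<le> - (29/50 * real n)" using N that unfolding Q_def by blast
    then show ?thesis unfolding v_def by (rule someI_ex)
  qed
  have up: "G i t \<le> 11/10 * real n" if "N \<le> n" "i \<in> {a, b, c}" "0 \<le> t" "t \<le> T i n" for n i t
    using N that unfolding Q_def by blast
  define P where "P = (\<lambda>x y z. (\<chi> k. if k = a then x else if k = b then y else if k = c then z else 0) :: real ^ 'd)"
  have P_nth: "P x y z $ k = (if k = a then x else if k = b then y else if k = c then z else 0)" for x y z k
    by (simp add: P_def)
  have split: "(\<Sum>k\<in>UNIV. F k) = F a + F b + F c + (\<Sum>k\<in>UNIV - {a, b, c}. F k)" for F :: "'d \<Rightarrow> real"
  proof -
    have "(\<Sum>k\<in>UNIV. F k) = (\<Sum>k\<in>UNIV - {a, b, c}. F k) + (\<Sum>k\<in>{a, b, c}. F k)"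
      by (rule sum.subset_diff) auto
    then show ?thesis using abc by simp
  qed
  have rest: "(\<Sum>k\<in>UNIV - {i}. G k (P x y z $ k)) = G a x + G b y + G c z + D - G i (P x y z $ i)" for i x y z
  proof -
    have "(\<Sum>k\<in>UNIV. G k (P x y z $ k)) = G i (P x y z $ i) + (\<Sum>k\<in>UNIV - {i}. G k (P x y z $ k))"
      by (rule sum.remove) auto
    \<comment> \<open>All coordinates other than \<open>a\<close>, \<open>b\<close>, \<open>c\<close> are kept at 0.\<close>
    moreover have "(\<Sum>k\<in>UNIV. G k (P x y z $ k)) = G a x + G b y + G c z + D"
      unfolding split D_def using abc by (auto simp: P_nth intro!: sum.cong)
    ultimately show ?thesis by simp
  qed
  define p where "p = (\<lambda>n. P (v n a) (v n b) (v n c))"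
  have step: "connected_component S (p n) (p (Suc n))" if n: "N \<le> n" for n
  proof -
    have n': "N \<le> Suc n" using n by simp
    have v1: "0 \<le> v n i" "v n i \<le> T i (Suc n)" "G i (v n i) \<le> - (29/50 * real n)" if "i \<in> {a, b, c}" for i
      using v[OF n that] T[of i n] by auto
    have v2: "0 \<le> v (Suc n) i" "v (Suc n) i \<le> T i (Suc n)" "G i (v (Suc n) i) \<le> - (29/50 * real n)" if "i \<in> {a, b, c}" for i
      using v[OF n' that] by (auto simp: field_simps)
    have u: "G i t \<le> 11/10 * real n + 11/10" if "i \<in> {a, b, c}" "0 \<le> t" "t \<le> T i (Suc n)" for i t
      using up[OF n' that] by (simp add: algebra_simps)
    have l: "11/10 - 6/100 * real n + D \<le> l" using N n by blast
    have "connected_component S (P (v n a) (v n b) (v n c)) (\<chi> k. if k = a then v (Suc n) a else P (v n a) (v n b) (v n c) $ k)"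
      unfolding S_def
    proof (rule coordinate_line_connected[where T = "T a (Suc n)"])
      show "G a t + (\<Sum>k\<in>UNIV - {a}. G k (P (v n a) (v n b) (v n c) $ k)) \<le> l" if "0 \<le> t" "t \<le> T a (Suc n)" for t
        using u[of a t] that v1(3)[of b] v1(3)[of c] l unfolding rest by (simp add: P_nth)
    qed (use v1[of a] v2[of a] in \<open>simp_all add: P_nth\<close>)
    also have "(\<chi> k. if k = a then v (Suc n) a else P (v n a) (v n b) (v n c) $ k) = P (v (Suc n) a) (v n b) (v n c)"
      using abc by (simp add: vec_eq_iff P_nth)
    finally have 1: "connected_component S (p n) (P (v (Suc n) a) (v n b) (v n c))" by (simp add: p_def)
    have "connected_component S (P (v (Suc n) a) (v n b) (v n c)) (\<chi> k. if k = b then v (Suc n) b else P (v (Suc n) a) (v n b) (v n c) $ k)"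
      unfolding S_def
    proof (rule coordinate_line_connected[where T = "T b (Suc n)"])
      show "G b t + (\<Sum>k\<in>UNIV - {b}. G k (P (v (Suc n) a) (v n b) (v n c) $ k)) \<le> l" if "0 \<le> t" "t \<le> T b (Suc n)" for t
        using u[of b t] that v2(3)[of a] v1(3)[of c] l abc unfolding rest by (simp add: P_nth)
    qed (use v1[of b] v2[of b] abc in \<open>simp_all add: P_nth\<close>)
    also have "(\<chi> k. if k = b then v (Suc n) b else P (v (Suc n) a) (v n b) (v n c) $ k) = P (v (Suc n) a) (v (Suc n) b) (v n c)"
      using abc by (simp add: vec_eq_iff P_nth)
    finally have 2: "connected_component S (P (v (Suc n) a) (v n b) (v n c)) (P (v (Suc n) a) (v (Suc n) b) (v n c))" .
    have "connected_component S (P (v (Suc n) a) (v (Suc n) b) (v n c)) (\<chi> k. if k = c then v (Suc n) c else P (v (Suc n) a) (v (Suc n) b) (v n c) $ k)"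
      unfolding S_def
    proof (rule coordinate_line_connected[where T = "T c (Suc n)"])
      show "G c t + (\<Sum>k\<in>UNIV - {c}. G k (P (v (Suc n) a) (v (Suc n) b) (v n c) $ k)) \<le> l" if "0 \<le> t" "t \<le> T c (Suc n)" for t
        using u[of c t] that v2(3)[of a] v2(3)[of b] l abc unfolding rest by (simp add: P_nth)
    qed (use v1[of c] v2[of c] abc in \<open>simp_all add: P_nth\<close>)
    also have "(\<chi> k. if k = c then v (Suc n) c else P (v (Suc n) a) (v (Suc n) b) (v n c) $ k) = p (Suc n)"
      using abc by (simp add: vec_eq_iff P_nth p_def)
    finally have 3: "connected_component S (P (v (Suc n) a) (v (Suc n) b) (v n c)) (p (Suc n))" .
    show ?thesis using 1 2 3 by (blast intro: connected_component_trans)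
  qed
  have chain: "connected_component S (p N) (p (N + n))" for n
  proof (induction n)
    case 0
    have "p N \<in> S" using connected_component_in[OF step[of N]] by simp
    then show ?case by (simp add: connected_component_refl)
  next
    case (Suc n)
    then show ?case using step[of "N + n"] connected_component_trans by fastforce
  qed
  let ?C = "connected_component_set S (p N)"
  have "?C \<in> components S" unfolding components_def using connected_component_in[OF chain[of 0]] by blast
  moreover have "\<not> bounded ?C"
  proof
    assume "bounded ?C"
    then obtain B where B: "\<And>x. x \<in> ?C \<Longrightarrow> norm x \<le> B" by (auto simp: bounded_iff)
    have vB: "v (N + n) a \<in> {-B..B}" for n
    proof -
      have "\<bar>p (N + n) $ a\<bar> \<le> norm (p (N + n))" by (rule component_le_norm_cart)
      also have "\<dots> \<le> B" by (rule B) (simp add: chain)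
      finally show ?thesis by (auto simp: p_def P_nth abs_le_iff)
    qed
    have "compact (G a ` {-B..B})"
      by (intro compact_continuous_image continuous_on_subset[OF cont]) auto
    then obtain m where m: "\<And>t. t \<in> {-B..B} \<Longrightarrow> \<bar>G a t\<bar> \<le> m"
      using compact_imp_bounded by (fastforce simp: bounded_iff)
    obtain n :: nat where "2 * m < n" using reals_Archimedean2 by blast
    moreover have "G a (v (N + n) a) \<le> - (29/50 * real (N + n))" using v[of "N + n" a] by simp
    moreover have "- m \<le> G a (v (N + n) a)" using m[OF vB[of n]] by linarith
    moreover have "0 \<le> real N" by simp
    ultimately show False by (simp add: field_simps)
  qed
  ultimately show ?thesis unfolding S_def by blast
qed

section \<open>The random field\<close>

lemma (in prob_space) centred_normal_of_gaussian_rv: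
  assumes Y: "gaussian_rv M Y" and mean: "expectation Y = 0"
  shows "\<exists>v. centred_normal M v Y"
proof -
  obtain m s where ms: "0 \<le> s" "if s = 0 then AE \<omega> in M. Y \<omega> = m else distributed M lborel Y (normal_density m s)"
    and [measurable]: "Y \<in> borel_measurable M"
    using Y unfolding gaussian_rv_def by (elim conjE exE)
  show ?thesis
  proof (cases "s = 0")
    case True
    then have ae: "AE \<omega> in M. Y \<omega> = m" using ms by simp
    then have "expectation Y = expectation (\<lambda>_. m)" by (intro integral_cong_AE) auto
    then have "m = 0" using mean by (simp add: prob_space)
    then show ?thesis using ae by (intro exI[of _ 0]) (simp add: centred_normal_def)
  next
    case False
    then have D: "distributed M lborel Y (normal_density m s)" and s: "0 < s" using ms by auto
    then have "m = 0" using normal_distributed_expectation[OF s D] mean by simp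
    then show ?thesis using D s by (intro exI[of _ "s\<^sup>2"]) (simp add: centred_normal_def)
  qed
qed

lemma stationary_covariance:
  assumes "stationary_process M X" and X[measurable]: "\<And>t. X t \<in> borel_measurable M"
  shows "(\<integral>\<omega>. X s \<omega> * X t \<omega> \<partial>M) = covariance_kernel M X (t - s)"
proof -
  let ?T = "{0, t - s}" and ?f = "\<lambda>y :: real \<Rightarrow> real. y 0 * y (t - s)"
  have [measurable]: "(\<lambda>\<omega>. \<lambda>u\<in>?T. X (u + r) \<omega>) \<in> measurable M (Pi\<^sub>M ?T (\<lambda>_. borel))" for r
    by (rule measurable_restrict) simp
  have [measurable]: "?f \<in> borel_measurable (Pi\<^sub>M ?T (\<lambda>_. borel))"
    by (intro borel_measurable_times measurable_component_singleton) auto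
  have shift: "(\<integral>y. ?f y \<partial>distr M (Pi\<^sub>M ?T (\<lambda>_. borel)) (\<lambda>\<omega>. \<lambda>u\<in>?T. X (u + r) \<omega>)) =
      (\<integral>\<omega>. X (0 + r) \<omega> * X (t - s + r) \<omega> \<partial>M)" for r
    by (subst integral_distr) (simp_all only: restrict_apply' insert_iff simp_thms, measurable)
  have "distr M (Pi\<^sub>M ?T (\<lambda>_. borel)) (\<lambda>\<omega>. \<lambda>u\<in>?T. X (u + s) \<omega>) =
      distr M (Pi\<^sub>M ?T (\<lambda>_. borel)) (\<lambda>\<omega>. \<lambda>u\<in>?T. X (u + 0) \<omega>)"
    using assms(1)[unfolded stationary_process_def, rule_format, of ?T s] by (simp only: add_0_right finite.intros)
  then have "(\<integral>\<omega>. X (0 + s) \<omega> * X (t - s + s) \<omega> \<partial>M) = (\<integral>\<omega>. X (0 + 0) \<omega> * X (t - s + 0) \<omega> \<partial>M)"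
    using shift[of s] shift[of 0] by (simp only:)
  then show ?thesis by (simp add: covariance_kernel_def)
qed

text \<open>
  The variance is positive: otherwise the process would vanish almost surely at each rational time,
  and by continuity at all times.
\<close>

lemma stationary_gaussian_of_process:
  assumes "prob_space M" and G: "gaussian_process M X" and centred: "centred_process M X"
    and stat: "stationary_process M X" and nonzero: "\<not> (AE \<omega> in M. \<forall>t. X t \<omega> = 0)"
    and smooth: "AE \<omega> in M. C2_smooth (\<lambda>t. X t \<omega>)"
    and decay: "((\<lambda>t. covariance_kernel M X t * ln \<bar>t\<bar>) \<longlongrightarrow> 0) at_infinity"
  shows "stationary_gaussian M X (covariance_kernel M X)"
proof -
  interpret prob_space M by fact
  have [measurable]: "X t \<in> borel_measurable M" for t
    using centred unfolding centred_process_def by (blast intro: borel_measurable_integrable)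
  have cov: "expectation (\<lambda>\<omega>. X s \<omega> * X t \<omega>) = covariance_kernel M X (t - s)" for s t
    by (rule stationary_covariance[OF stat]) simp
  have comb: "\<exists>v. centred_normal M v (\<lambda>\<omega>. \<Sum>t\<in>T. a t * X t \<omega>)" if "finite T" for T a
  proof (rule centred_normal_of_gaussian_rv)
    show "gaussian_rv M (\<lambda>\<omega>. \<Sum>t\<in>T. a t * X t \<omega>)" using G that unfolding gaussian_process_def by simp
    show "expectation (\<lambda>\<omega>. \<Sum>t\<in>T. a t * X t \<omega>) = 0"
      using centred unfolding centred_process_def by simp
  qed
  interpret gaussian_family M X by standard (rule comb)
  have "covariance_kernel M X 0 \<noteq> 0"
  proof
    assume 0: "covariance_kernel M X 0 = 0"
    have "AE \<omega> in M. X t \<omega> = 0" for t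
    proof -
      have "expectation (\<lambda>\<omega>. (X t \<omega>)\<^sup>2) = 0" using cov[of t t] 0 by (simp add: power2_eq_square)
      then have "AE \<omega> in M. (X t \<omega>)\<^sup>2 = 0"
        using integral_nonneg_eq_0_iff_AE[OF X_square_integrable[of t]] by simp
      then show ?thesis by eventually_elim simp
    qed
    then have "AE \<omega> in M. \<forall>q::rat. X (of_rat q) \<omega> = 0" by (subst AE_all_countable) blast
    then have "AE \<omega> in M. \<forall>t. X t \<omega> = 0"
      using smooth
    proof (eventually_elim, intro allI)
      fix \<omega> t assume q: "\<forall>q::rat. X (of_rat q) \<omega> = 0" and "C2_smooth (\<lambda>t. X t \<omega>)"
      then have cont: "continuous_on (closure \<rat>) (\<lambda>t. X t \<omega>)"
        unfolding C2_smooth_def by (blast intro: DERIV_isCont continuous_at_imp_continuous_on)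
      show "X t \<omega> = 0"
        by (rule continuous_constant_on_closure[OF cont]) (use q in \<open>auto simp: Rats_closure_real elim: Rats_cases\<close>)
    qed
    then show False using nonzero by contradiction
  qed
  moreover have "0 \<le> covariance_kernel M X 0" by (simp add: covariance_kernel_def)
  moreover have "((\<lambda>t. covariance_kernel M X t * ln t) \<longlongrightarrow> 0) at_top"
  proof (rule Lim_transform_eventually)
    show "((\<lambda>t. covariance_kernel M X t * ln \<bar>t\<bar>) \<longlongrightarrow> 0) at_top"
      by (rule tendsto_mono[OF at_top_le_at_infinity decay])
    show "\<forall>\<^sub>F t in at_top. covariance_kernel M X t * ln \<bar>t\<bar> = covariance_kernel M X t * ln t"
      using eventually_ge_at_top[of 0] by eventually_elim simp
  qed
  ultimately show ?thesis
    using cov smooth by unfold_locales auto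
qed

theorem theorem1p5:
  fixes M :: "'w measure"
    and g :: "'d::finite \<Rightarrow> real \<Rightarrow> 'w \<Rightarrow> real"
    and f :: "real ^ 'd \<Rightarrow> 'w \<Rightarrow> real"
  assumes "prob_space M"
    and "CARD('d) \<ge> 3"
    and "gaussian_process M f"
    and "\<And>x \<omega>. f x \<omega> = (\<Sum>i\<in>UNIV. g i (x $ i) \<omega>)"
    and "indep_processes M g"
    and "\<And>i. gaussian_process M (g i)"
    and "\<And>i. centred_process M (g i)"
    and "\<And>i. stationary_process M (g i)"
    and "\<And>i. \<not> (AE \<omega> in M. \<forall>t. g i t \<omega> = 0)"
    and "\<And>i. AE \<omega> in M. C2_smooth (\<lambda>t. g i t \<omega>)"
    and "\<And>i. ((\<lambda>t. covariance_kernel M (g i) t * ln \<bar>t\<bar>) \<longlongrightarrow> 0) at_infinity"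
  shows "is_critical_level M f (-\<infinity>) \<and>
         (\<forall>l. AE \<omega> in M. \<exists>C\<in>components (sublevel_set f l \<omega>). \<not> bounded C)"
proof -
  define K where "K = (\<lambda>i. covariance_kernel M (g i))"
  have sg: "stationary_gaussian M (g i) (K i)" for i
    unfolding K_def by (rule stationary_gaussian_of_process) (rule assms)+
  obtain A :: "'d set" where "card A = 3" using obtain_subset_with_card_n[OF assms(2)] by metis
  then obtain a b c where "A = {a, b, c}" and abc: "a \<noteq> b" "b \<noteq> c" "a \<noteq> c"
    unfolding card_3_iff by (elim exE conjE)
  have upper: "AE \<omega> in M. \<forall>\<^sub>F n in sequentially. \<forall>t. 0 \<le> t \<and> t \<le> exp ((real n)\<^sup>2 / (2 * K i 0)) \<longrightarrow> g i t \<omega> \<le> 11/10 * real n" for i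
    by (rule stationary_gaussian.eventually_upper_bound[OF sg])
  have lower: "AE \<omega> in M. \<forall>\<^sub>F n in sequentially. \<exists>t. 0 \<le> t \<and> t \<le> exp ((real n)\<^sup>2 / (2 * K i 0)) \<and> g i t \<omega> \<le> - (29/50 * real n)" for i
    by (rule stationary_gaussian.eventually_low_point[OF sg])
  have "AE \<omega> in M. \<exists>C\<in>components (sublevel_set f l \<omega>). \<not> bounded C" for l
    using upper[of a] upper[of b] upper[of c] lower[of a] lower[of b] lower[of c] assms(10)[of a]
  proof eventually_elim
    case (elim \<omega>)
    have "sublevel_set f l \<omega> = {x. (\<Sum>k\<in>UNIV. g k (x $ k) \<omega>) \<le> l}"
      by (simp add: sublevel_set_def assms(4))
    moreover have "\<exists>C\<in>components {x. (\<Sum>k\<in>UNIV. g k (x $ k) \<omega>) \<le> l}. \<not> bounded C"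
    proof (rule unbounded_component_of_deep_valleys[OF abc(1) abc(3) abc(2), where T = "\<lambda>i n. exp ((real n)\<^sup>2 / (2 * K i 0))"])
      show "exp ((real n)\<^sup>2 / (2 * K i 0)) \<le> exp ((real (Suc n))\<^sup>2 / (2 * K i 0))" for i n
        using stationary_gaussian.variance_pos[OF sg[of i]] by (simp add: divide_right_mono power_mono)
      show "continuous_on UNIV (\<lambda>t. g a t \<omega>)"
        using elim(7) unfolding C2_smooth_def by (blast intro: DERIV_isCont continuous_at_imp_continuous_on)
    qed (use elim in auto)
    ultimately show ?case by simp
  qed
  then show ?thesis by (auto simp: is_critical_level_def)
qed

end
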